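(* Let $\mathcal{M}$ be a unitary magma. Then the space $\mathsf{Bub}\mathcal{M}=\mathsf{C}\mathcal{M}/\mathfrak{R}_{\mathsf{Bub}\mathcal{M}}$ is a quotient operad of $\mathsf{C}\mathcal{M}$ (that is, $\mathfrak{R}_{\mathsf{Bub}\mathcal{M}}$ is an operad ideal of $\mathsf{C}\mathcal{M}$).
   Context: Let $\mathbb{K}$ be a field of characteristic zero and $[n]=\{1,\dots,n\}$. A unitary magma is a set $\mathcal{M}$ with a binary operation $\star$ (not assumed associative) having a two-sided unit $\mathbb{1}_{\mathcal{M}}$. Operads are nonsymmetric operads in $\mathbb{K}$-vector spaces (graded from arity $1$, with partial compositions $\circ_i$ and a unit of arity $1$). An operad ideal of $\mathcal{O}$ is a graded subspace $I$ such that $x\circ_i y$ and $y\circ_j x$ are in $I$ for all $x\in\mathcal{O}$, $y\in I$ and valid $i,j$; then $\mathcal{O}/I$ is a quotient operad. An $\mathcal{M}$-clique of arity $n\ge1$ is a map $\mathfrak{p}$ assigning a label $\mathfrak{p}(x,y)\in\mathcal{M}$ to each arc $(x,y)$, $1\le x<y\le n+1$; by convention the only $\mathcal{M}$-clique of arity $1$ is $\mathbf{u}$, with $\mathbf{u}(1,2)=\mathbb{1}_{\mathcal{M}}$. The arc $(1,n+1)$ is the base; the arcs $(x,x+1)$ different from $(1,n+1)$ are the edges; all other arcs are diagonals. An arc is solid if its label is not $\mathbb{1}_{\mathcal{M}}$. Write $\mathfrak{p}_0:=\mathfrak{p}(1,n+1)$ and $\mathfrak{p}_i:=\mathfrak{p}(i,i+1)$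 for $i\in[n]$. $\mathsf{C}\mathcal{M}$ is the operad (with unit $\mathbf{u}$) such that $\mathsf{C}\mathcal{M}(n)$ has basis the $\mathcal{M}$-cliques of arity $n$, and for $\mathcal{M}$-cliques $\mathfrak{p},\mathfrak{q}$ of arities $n,m$ and $i\in[n]$, $\mathfrak{p}\circ_i\mathfrak{q}$ is the $\mathcal{M}$-clique of arity $n+m-1$ with, for $1\le x<y\le n+m$, $$(\mathfrak{p}\circ_i\mathfrak{q})(x,y)=\begin{cases}\mathfrak{p}(x,y)&\text{if }y\le i,\\ \mathfrak{p}(x,y-m+1)&\text{if }x\le i<i+m\le y,\ (x,y)\ne(i,i+m),\\ \mathfrak{p}(x-m+1,y-m+1)&\text{if }i+m\le x,\\ \mathfrak{q}(x-i+1,y-i+1)&\text{if }i\le x<y\le i+m,\ (x,y)\ne(i,i+m),\\ \mathfrak{p}_i\star\mathfrak{q}_0&\text{if }(x,y)=(i,i+m),\\ \mathbb{1}_{\mathcal{M}}&\text{otherwise}.\end{cases}$$ An $\mathcal{M}$-bubble is an $\mathcal{M}$-clique with no solid diagonal. $\mathfrak{R}_{\mathsf{Bub}\mathcal{M}}$ is the subspace of $\mathsf{C}\mathcal{M}$ spanned by all $\mathcal{M}$-cliques that are not $\mathcal{M}$-bubbles. *)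

theory Defs
  imports "HOL-Algebra.Module" "HOL-Algebra.AbelCoset"
begin

section \<open>Nonsymmetric operads in vector spaces\<close>

text \<open>
  Only the components of arity \<open>n \<ge> 1\<close> are meaningful. The first two arguments of
  \<open>pcomp\<close> are the arities of the two elements being composed, the third one is the
  (1-based) input at which the composition takes place. Of the record \<open>module\<close>, only the
  additive group and the scalar multiplication are used; its ring multiplication and
  ring unit are irrelevant.
\<close>

record ('k, 'v) ns_operad =
  component :: "nat \<Rightarrow> ('k, 'v) module"
  pcomp :: "nat \<Rightarrow> nat \<Rightarrow> nat \<Rightarrow> 'v \<Rightarrow> 'v \<Rightarrow> 'v"
  operad_unit :: "'v"

locale ns_operad = K?: field K for K :: "('k, 'l) ring_scheme" (structure) +
  fixes P :: "('k, 'v) ns_operad"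
  assumes component_module: "1 \<le> n \<Longrightarrow> module K (component P n)"
    and pcomp_closed:
      "\<lbrakk>1 \<le> m; 1 \<le> i; i \<le> n; x \<in> carrier (component P n); y \<in> carrier (component P m)\<rbrakk>
        \<Longrightarrow> pcomp P n m i x y \<in> carrier (component P (n + m - 1))"
    and pcomp_add_left:
      "\<lbrakk>1 \<le> m; 1 \<le> i; i \<le> n; x \<in> carrier (component P n); x' \<in> carrier (component P n);
        y \<in> carrier (component P m)\<rbrakk>
        \<Longrightarrow> pcomp P n m i (x \<oplus>\<^bsub>component P n\<^esub> x') y
          = pcomp P n m i x y \<oplus>\<^bsub>component P (n + m - 1)\<^esub> pcomp P n m i x' y"
    and pcomp_add_right:
      "\<lbrakk>1 \<le> m; 1 \<le> i; i \<le> n; x \<in> carrier (component P n); y \<in> carrier (component P m);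
        y' \<in> carrier (component P m)\<rbrakk>
        \<Longrightarrow> pcomp P n m i x (y \<oplus>\<^bsub>component P m\<^esub> y')
          = pcomp P n m i x y \<oplus>\<^bsub>component P (n + m - 1)\<^esub> pcomp P n m i x y'"
    and pcomp_smult_left:
      "\<lbrakk>1 \<le> m; 1 \<le> i; i \<le> n; a \<in> carrier K; x \<in> carrier (component P n);
        y \<in> carrier (component P m)\<rbrakk>
        \<Longrightarrow> pcomp P n m i (a \<odot>\<^bsub>component P n\<^esub> x) y
          = a \<odot>\<^bsub>component P (n + m - 1)\<^esub> pcomp P n m i x y"
    and pcomp_smult_right:
      "\<lbrakk>1 \<le> m; 1 \<le> i; i \<le> n; a \<in> carrier K; x \<in> carrier (component P n);
        y \<in> carrier (component P m)\<rbrakk>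
        \<Longrightarrow> pcomp P n m i x (a \<odot>\<^bsub>component P m\<^esub> y)
          = a \<odot>\<^bsub>component P (n + m - 1)\<^esub> pcomp P n m i x y"
    and series_assoc:
      "\<lbrakk>1 \<le> l; 1 \<le> i; i \<le> n; 1 \<le> j; j \<le> m; x \<in> carrier (component P n);
        y \<in> carrier (component P m); z \<in> carrier (component P l)\<rbrakk>
        \<Longrightarrow> pcomp P (n + m - 1) l (i + j - 1) (pcomp P n m i x y) z
          = pcomp P n (m + l - 1) i x (pcomp P m l j y z)"
    and parallel_assoc:
      "\<lbrakk>1 \<le> m; 1 \<le> l; 1 \<le> i; i < j; j \<le> n; x \<in> carrier (component P n);
        y \<in> carrier (component P m); z \<in> carrier (component P l)\<rbrakk>
        \<Longrightarrow> pcomp P (n + m - 1) l (j + m - 1) (pcomp P n m i x y) z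
          = pcomp P (n + l - 1) m i (pcomp P n l j x z) y"
    and unit_closed: "operad_unit P \<in> carrier (component P 1)"
    and unit_left:
      "\<lbrakk>1 \<le> n; x \<in> carrier (component P n)\<rbrakk> \<Longrightarrow> pcomp P 1 n 1 (operad_unit P) x = x"
    and unit_right:
      "\<lbrakk>1 \<le> i; i \<le> n; x \<in> carrier (component P n)\<rbrakk>
        \<Longrightarrow> pcomp P n 1 i x (operad_unit P) = x"

locale operad_ideal = ns_operad K P for K :: "('k, 'l) ring_scheme" (structure) and P :: "('k, 'v) ns_operad" +
  fixes I :: "nat \<Rightarrow> 'v set"
  assumes ideal_submodule: "1 \<le> n \<Longrightarrow> submodule (I n) K (component P n)"
    and ideal_right:
      "\<lbrakk>1 \<le> m; 1 \<le> i; i \<le> n; x \<in> carrier (component P n); y \<in> I m\<rbrakk>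
        \<Longrightarrow> pcomp P n m i x y \<in> I (n + m - 1)"
    and ideal_left:
      "\<lbrakk>1 \<le> n; 1 \<le> j; j \<le> m; x \<in> carrier (component P n); y \<in> I m\<rbrakk>
        \<Longrightarrow> pcomp P m n j y x \<in> I (m + n - 1)"

text \<open>
  In the quotient, operations on cosets are computed on representatives; the unions over all
  representatives avoid a choice, and they are single cosets when \<open>I\<close> is an operad ideal.
\<close>

definition quotient_module :: "('k, 'v) module \<Rightarrow> 'v set \<Rightarrow> ('k, 'v set) module" where
  "quotient_module V N =
    \<lparr>carrier = a_rcosets\<^bsub>V\<^esub> N, mult = undefined, one = undefined,
     zero = N, add = set_add V, smult = (\<lambda>a A. \<Union>x\<in>A. N +>\<^bsub>V\<^esub> (a \<odot>\<^bsub>V\<^esub> x))\<rparr>"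

definition quotient_operad ::
    "('k, 'v) ns_operad \<Rightarrow> (nat \<Rightarrow> 'v set) \<Rightarrow> ('k, 'v set) ns_operad" where
  "quotient_operad P I =
    \<lparr>component = (\<lambda>n. quotient_module (component P n) (I n)),
     pcomp = (\<lambda>n m i A B. \<Union>x\<in>A. \<Union>y\<in>B.
       I (n + m - 1) +>\<^bsub>component P (n + m - 1)\<^esub> pcomp P n m i x y),
     operad_unit = I 1 +>\<^bsub>component P 1\<^esub> operad_unit P\<rparr>"

definition module_span :: "('k, 'm) ring_scheme \<Rightarrow> ('k, 'v) module \<Rightarrow> 'v set \<Rightarrow> 'v set" where
  "module_span K V S = \<Inter>{N. submodule N K V \<and> S \<subseteq> N}"


section \<open>Unitary magmas and cliques\<close>

locale unitary_magma =
  fixes M :: "('a, 'm) monoid_scheme" (structure)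
  assumes magma_closed: "\<lbrakk>x \<in> carrier M; y \<in> carrier M\<rbrakk> \<Longrightarrow> x \<otimes> y \<in> carrier M"
    and magma_one_closed: "\<one> \<in> carrier M"
    and magma_l_one: "x \<in> carrier M \<Longrightarrow> \<one> \<otimes> x = x"
    and magma_r_one: "x \<in> carrier M \<Longrightarrow> x \<otimes> \<one> = x"

definition arcs :: "nat \<Rightarrow> (nat \<times> nat) set" where
  "arcs n = {(x, y). 1 \<le> x \<and> x < y \<and> y \<le> n + 1}"

definition diagonals :: "nat \<Rightarrow> (nat \<times> nat) set" where
  "diagonals n = {(x, y) \<in> arcs n. (x, y) \<noteq> (1, n + 1) \<and> y \<noteq> x + 1}"

definition cliques :: "('a, 'm) monoid_scheme \<Rightarrow> nat \<Rightarrow> (nat \<times> nat \<Rightarrow> 'a) set" where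
  "cliques M n = {p \<in> arcs n \<rightarrow>\<^sub>E carrier M. n = 1 \<longrightarrow> p (1, 2) = \<one>\<^bsub>M\<^esub>}"

definition unit_clique :: "('a, 'm) monoid_scheme \<Rightarrow> nat \<times> nat \<Rightarrow> 'a" where
  "unit_clique M = (\<lambda>a\<in>arcs 1. \<one>\<^bsub>M\<^esub>)"

definition bubbles :: "('a, 'm) monoid_scheme \<Rightarrow> nat \<Rightarrow> (nat \<times> nat \<Rightarrow> 'a) set" where
  "bubbles M n = {p \<in> cliques M n. \<forall>a\<in>diagonals n. p a = \<one>\<^bsub>M\<^esub>}"

definition clique_comp :: "('a, 'm) monoid_scheme \<Rightarrow> nat \<Rightarrow> nat \<Rightarrow> nat
    \<Rightarrow> (nat \<times> nat \<Rightarrow> 'a) \<Rightarrow> (nat \<times> nat \<Rightarrow> 'a) \<Rightarrow> nat \<times> nat \<Rightarrow> 'a" where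
  "clique_comp M n m i p q = (\<lambda>(x, y)\<in>arcs (n + m - 1).
     if y \<le> i then p (x, y)
     else if x \<le> i \<and> i + m \<le> y \<and> (x, y) \<noteq> (i, i + m) then p (x, y - m + 1)
     else if i + m \<le> x then p (x - m + 1, y - m + 1)
     else if i \<le> x \<and> y \<le> i + m \<and> (x, y) \<noteq> (i, i + m) then q (x - i + 1, y - i + 1)
     else if (x, y) = (i, i + m) then p (i, i + 1) \<otimes>\<^bsub>M\<^esub> q (1, m + 1)
     else \<one>\<^bsub>M\<^esub>)"


section \<open>The clique operad\<close>

text \<open>
  Formal linear combinations of cliques of arity \<open>n\<close> are finitely supported coefficient
  functions; they are zero at every argument that is not a clique of arity \<open>n\<close>.
\<close>

definition clique_space ::
    "('k, 'l) ring_scheme \<Rightarrow> ('a, 'm) monoid_scheme \<Rightarrow> nat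
      \<Rightarrow> ('k, (nat \<times> nat \<Rightarrow> 'a) \<Rightarrow> 'k) module" where
  "clique_space K M n =
    \<lparr>carrier = {f. range f \<subseteq> carrier K \<and> finite {p. f p \<noteq> \<zero>\<^bsub>K\<^esub>}
                  \<and> {p. f p \<noteq> \<zero>\<^bsub>K\<^esub>} \<subseteq> cliques M n},
     mult = undefined, one = undefined,
     zero = (\<lambda>p. \<zero>\<^bsub>K\<^esub>), add = (\<lambda>f g p. f p \<oplus>\<^bsub>K\<^esub> g p), smult = (\<lambda>a f p. a \<otimes>\<^bsub>K\<^esub> f p)\<rparr>"

definition clique_basis ::
    "('k, 'l) ring_scheme \<Rightarrow> (nat \<times> nat \<Rightarrow> 'a) \<Rightarrow> (nat \<times> nat \<Rightarrow> 'a) \<Rightarrow> 'k" where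
  "clique_basis K p = (\<lambda>q. if q = p then \<one>\<^bsub>K\<^esub> else \<zero>\<^bsub>K\<^esub>)"

text \<open>
  The partial compositions are the bilinear extensions of \<open>clique_comp\<close>: the coefficient at
  \<open>r\<close> collects the products of coefficients over all pairs of cliques that compose to \<open>r\<close>.
\<close>

definition clique_operad ::
    "('k, 'l) ring_scheme \<Rightarrow> ('a, 'm) monoid_scheme
      \<Rightarrow> ('k, (nat \<times> nat \<Rightarrow> 'a) \<Rightarrow> 'k) ns_operad" where
  "clique_operad K M =
    \<lparr>component = clique_space K M,
     pcomp = (\<lambda>n m i f g r.
       \<Oplus>\<^bsub>K\<^esub>c\<in>{(p, q). f p \<noteq> \<zero>\<^bsub>K\<^esub> \<and> g q \<noteq> \<zero>\<^bsub>K\<^esub> \<and> clique_comp M n m i p q = r}.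
         f (fst c) \<otimes>\<^bsub>K\<^esub> g (snd c)),
     operad_unit = clique_basis K (unit_clique M)\<rparr>"

definition bubble_relations ::
    "('k, 'l) ring_scheme \<Rightarrow> ('a, 'm) monoid_scheme \<Rightarrow> nat
      \<Rightarrow> ((nat \<times> nat \<Rightarrow> 'a) \<Rightarrow> 'k) set" where
  "bubble_relations K M n =
    module_span K (clique_space K M n) (clique_basis K ` (cliques M n - bubbles M n))"

definition bubble_operad ::
    "('k, 'l) ring_scheme \<Rightarrow> ('a, 'm) monoid_scheme
      \<Rightarrow> ('k, ((nat \<times> nat \<Rightarrow> 'a) \<Rightarrow> 'k) set) ns_operad" where
  "bubble_operad K M = quotient_operad (clique_operad K M) (bubble_relations K M)"

end

theory Submission
  imports Defs
begin

text \<open>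
  The composite \<open>p \<circ>\<^sub>i q\<close> glues the base of \<open>q\<close> to the \<open>i\<close>-th edge of \<open>p\<close> and keeps every other label;
  the arcs that cross the glued arc are not solid. A solid diagonal is neither a base nor an edge, so it
  is still a solid diagonal of the composite. Hence a composite of two cliques one of which is not a
  bubble is not a bubble (\<open>clique_comp_not_bubble_right\<close>, \<open>clique_comp_not_bubble_left\<close>), and since the
  compositions are bilinear, the span of the non-bubbles is closed under composition with arbitrary
  elements.

  That cliques form an operad at all is checked on cliques first. Series and parallel associativity
  (\<open>clique_comp_series\<close>, \<open>clique_comp_parallel\<close>) hold label by label, according to the position of an arc
  relative to the two grafted polygons. They extend to linear combinations because both sides are
  trilinear and the cliques span (\<open>trilinear_eq_on_basis\<close>).

  Finally, the quotient of any operad by an operad ideal is an operad (\<open>quotient_operad\<close>): the operations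
  on cosets are computed by representatives, and the axioms pass to the cosets.
\<close>

section \<open>Composition of cliques\<close>

text \<open>
  Relative to the interval from \<open>i\<close> to \<open>i + m\<close>, onto which the vertices of \<open>q\<close> are mapped, an arc of
  \<open>p \<circ>\<^sub>i q\<close> lies before it, around it, after it or inside it, is the arc along which the
  two polygons are glued, or crosses it. The next six lemmas read off the label in each of
  these cases. The arcs of \<open>p\<close> and \<open>q\<close> are given by additive side conditions rather than by
  subtraction, so that iterated compositions can be compared by linear arithmetic.
\<close>

lemma clique_comp_before:
  "\<lbrakk>1 \<le> x; x < y; y \<le> i; i \<le> n; 1 \<le> m\<rbrakk> \<Longrightarrow> clique_comp M n m i p q (x, y) = p (x, y)"
  by (simp add: clique_comp_def arcs_def)

lemma clique_comp_around:
  "\<lbrakk>1 \<le> x; x \<le> i; i + m \<le> y; y \<le> n + m; x \<noteq> i \<or> y \<noteq> i + m; 1 \<le> m; Suc y = y' + m\<rbrakk>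
    \<Longrightarrow> clique_comp M n m i p q (x, y) = p (x, y')"
  by (auto simp: clique_comp_def arcs_def intro!: arg_cong[where f = p])

lemma clique_comp_after:
  "\<lbrakk>i + m \<le> x; x < y; y \<le> n + m; 1 \<le> i; 1 \<le> m; Suc x = x' + m; Suc y = y' + m\<rbrakk>
    \<Longrightarrow> clique_comp M n m i p q (x, y) = p (x', y')"
  by (auto simp: clique_comp_def arcs_def intro!: arg_cong[where f = p])

lemma clique_comp_inside:
  "\<lbrakk>i \<le> x; x < y; y \<le> i + m; x \<noteq> i \<or> y \<noteq> i + m; 1 \<le> i; i \<le> n; 1 \<le> m; Suc x = x' + i; Suc y = y' + i\<rbrakk>
    \<Longrightarrow> clique_comp M n m i p q (x, y) = q (x', y')"
  by (auto simp: clique_comp_def arcs_def intro!: arg_cong[where f = q])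

lemma clique_comp_graft:
  "\<lbrakk>1 \<le> i; i \<le> n; 1 \<le> m; x = i; y = i + m\<rbrakk>
    \<Longrightarrow> clique_comp M n m i p q (x, y) = p (i, Suc i) \<otimes>\<^bsub>M\<^esub> q (1, Suc m)"
  by (simp add: clique_comp_def arcs_def)

lemma clique_comp_crossing:
  "\<lbrakk>1 \<le> x; x < y; y \<le> n + m; x < i \<and> i < y \<and> y < i + m \<or> i < x \<and> x < i + m \<and> i + m < y; 1 \<le> m\<rbrakk>
    \<Longrightarrow> clique_comp M n m i p q (x, y) = \<one>\<^bsub>M\<^esub>"
  by (erule disjE) (simp_all add: clique_comp_def arcs_def)

lemma clique_comp_eqI:
  assumes "n + m = n' + m'" "1 \<le> m" "1 \<le> m'"
    and "\<And>x y. \<lbrakk>1 \<le> x; x < y; y \<le> n + m\<rbrakk>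
      \<Longrightarrow> clique_comp M n m i p q (x, y) = clique_comp M n' m' i' p' q' (x, y)"
  shows "clique_comp M n m i p q = clique_comp M n' m' i' p' q'"
proof
  fix a :: "nat \<times> nat"
  show "clique_comp M n m i p q a = clique_comp M n' m' i' p' q' a"
  proof (cases "a \<in> arcs (n + m - 1)")
    case True
    with assms(2) show ?thesis by (cases a) (auto simp: arcs_def intro!: assms(4))
  next
    case False
    with assms(1-3) show ?thesis by (simp add: clique_comp_def)
  qed
qed

text \<open>
  Grafting at two different edges of \<open>p\<close> gives the same clique in either order, for arbitrary labels:
  no arc is involved in both gluings.
\<close>

lemma clique_comp_parallel:
  assumes "1 \<le> m" "1 \<le> l" "1 \<le> i" "i < j" "j \<le> n"
  shows "clique_comp M (n + m - 1) l (j + m - 1) (clique_comp M n m i p q) r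
    = clique_comp M (n + l - 1) m i (clique_comp M n l j p r) q"
proof -
  \<comment> \<open>The polygon of \<open>r\<close> is mapped to the interval from \<open>c\<close> to \<open>c + l\<close>, and \<open>i + m \<le> c\<close>.\<close>
  define c where "c = j + m - 1"
  define N where "N = n + m - 1"
  define L where "L = n + l - 1"
  have eqs: "Suc c = j + m" "Suc N = n + m" "Suc L = n + l"
    using assms by (auto simp: c_def N_def L_def)
  let ?pq = "clique_comp M n m i p q" and ?pr = "clique_comp M n l j p r"
  let ?L = "clique_comp M N l c ?pq r" and ?R = "clique_comp M L m i ?pr q"
  have "?L = ?R"
  proof (rule clique_comp_eqI)
    show "N + l = L + m" "1 \<le> l" "1 \<le> m"
      using eqs assms by arith+
  next
    fix x y
    assume "1 \<le> x" "x < y" "y \<le> N + l"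
    note A = assms eqs this
    consider
        (before) "y \<le> i"
      | (inside_q) "i \<le> x" "i < y" "y \<le> i + m" "x \<noteq> i \<or> y \<noteq> i + m"
      | (graft_q) "x = i" "y = i + m"
      | (cross_q) "x < i \<and> i < y \<and> y < i + m \<or> i < x \<and> x < i + m \<and> i + m < y"
      | (outer1) "x \<le> i" "i + m \<le> y" "x \<noteq> i \<or> y \<noteq> i + m"
      | (outer2) "i + m \<le> x"
      by atomize_elim arith
    then show "?L (x, y) = ?R (x, y)"
    proof cases
      case before
      have "?L (x, y) = ?pq (x, y)"
        by (rule clique_comp_before) (use A before in arith)+
      also have "\<dots> = p (x, y)"
        by (rule clique_comp_before) (use A before in arith)+
      finally have L: "?L (x, y) = p (x, y)" .
      have "?R (x, y) = ?pr (x, y)"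
        by (rule clique_comp_before) (use A before in arith)+
      also have "\<dots> = p (x, y)"
        by (rule clique_comp_before) (use A before in arith)+
      finally have R: "?R (x, y) = p (x, y)" .
      from L R show ?thesis by simp
    next
      case inside_q
      have "?L (x, y) = ?pq (x, y)"
        by (rule clique_comp_before) (use A inside_q in arith)+
      also have "\<dots> = q (Suc x - i, Suc y - i)"
        by (rule clique_comp_inside) (use A inside_q in arith)+
      finally have L: "?L (x, y) = q (Suc x - i, Suc y - i)" .
      have R: "?R (x, y) = q (Suc x - i, Suc y - i)"
        by (rule clique_comp_inside) (use A inside_q in arith)+
      from L R show ?thesis by simp
    next
      case graft_q
      have "?L (x, y) = ?pq (x, y)"
        by (rule clique_comp_before) (use A graft_q in arith)+
      also have "\<dots> = p (i, Suc i) \<otimes>\<^bsub>M\<^esub> q (1, Suc m)"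
        by (rule clique_comp_graft) (use A graft_q in arith)+
      finally have L: "?L (x, y) = p (i, Suc i) \<otimes>\<^bsub>M\<^esub> q (1, Suc m)" .
      have R: "?R (x, y) = ?pr (i, Suc i) \<otimes>\<^bsub>M\<^esub> q (1, Suc m)"
        by (rule clique_comp_graft) (use A graft_q in arith)+
      have "?pr (i, Suc i) = p (i, Suc i)"
        by (rule clique_comp_before) (use A graft_q in arith)+
      with L R show ?thesis by simp
    next
      case cross_q
      consider (before_r) "y \<le> c"
        | (cross_r) "c < y" "y < c + l"
        | (around_r) "c + l \<le> y"
        by atomize_elim (use A cross_q in arith)
      then show ?thesis
      proof cases
        case before_r
        have "?L (x, y) = ?pq (x, y)"
          by (rule clique_comp_before) (use A cross_q before_r in arith)+
        also have "\<dots> = \<one>\<^bsub>M\<^esub>"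
          by (rule clique_comp_crossing) (use A cross_q before_r in arith)+
        finally have L: "?L (x, y) = \<one>\<^bsub>M\<^esub>" .
        have R: "?R (x, y) = \<one>\<^bsub>M\<^esub>"
          by (rule clique_comp_crossing) (use A cross_q before_r in arith)+
        from L R show ?thesis by simp
      next
        case cross_r
        have L: "?L (x, y) = \<one>\<^bsub>M\<^esub>"
          by (rule clique_comp_crossing) (use A cross_q cross_r in arith)+
        have R: "?R (x, y) = \<one>\<^bsub>M\<^esub>"
          by (rule clique_comp_crossing) (use A cross_q cross_r in arith)+
        from L R show ?thesis by simp
      next
        case around_r
        have "?L (x, y) = ?pq (x, Suc y - l)"
          by (rule clique_comp_around) (use A cross_q around_r in arith)+
        also have "\<dots> = \<one>\<^bsub>M\<^esub>"
          by (rule clique_comp_crossing) (use A cross_q around_r in arith)+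
        finally have L: "?L (x, y) = \<one>\<^bsub>M\<^esub>" .
        have R: "?R (x, y) = \<one>\<^bsub>M\<^esub>"
          by (rule clique_comp_crossing) (use A cross_q around_r in arith)+
        from L R show ?thesis by simp
      qed
    next
      case outer1
      consider (before_r) "y \<le> c"
        | (cross_r) "c < y" "y < c + l"
        | (around_r) "c + l \<le> y"
        by atomize_elim (use A outer1 in arith)
      then show ?thesis
      proof cases
        case before_r
        have "?L (x, y) = ?pq (x, y)"
          by (rule clique_comp_before) (use A outer1 before_r in arith)+
        also have "\<dots> = p (x, Suc y - m)"
          by (rule clique_comp_around) (use A outer1 before_r in arith)+
        finally have L: "?L (x, y) = p (x, Suc y - m)" .
        have "?R (x, y) = ?pr (x, Suc y - m)"
          by (rule clique_comp_around) (use A outer1 before_r in arith)+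
        also have "\<dots> = p (x, Suc y - m)"
          by (rule clique_comp_before) (use A outer1 before_r in arith)+
        finally have R: "?R (x, y) = p (x, Suc y - m)" .
        from L R show ?thesis by simp
      next
        case cross_r
        have L: "?L (x, y) = \<one>\<^bsub>M\<^esub>"
          by (rule clique_comp_crossing) (use A outer1 cross_r in arith)+
        have "?R (x, y) = ?pr (x, Suc y - m)"
          by (rule clique_comp_around) (use A outer1 cross_r in arith)+
        also have "\<dots> = \<one>\<^bsub>M\<^esub>"
          by (rule clique_comp_crossing) (use A outer1 cross_r in arith)+
        finally have R: "?R (x, y) = \<one>\<^bsub>M\<^esub>" .
        from L R show ?thesis by simp
      next
        case around_r
        have "?L (x, y) = ?pq (x, Suc y - l)"
          by (rule clique_comp_around) (use A outer1 around_r in arith)+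
        also have "\<dots> = p (x, Suc (Suc y - m) - l)"
          by (rule clique_comp_around) (use A outer1 around_r in arith)+
        finally have L: "?L (x, y) = p (x, Suc (Suc y - m) - l)" .
        have "?R (x, y) = ?pr (x, Suc y - m)"
          by (rule clique_comp_around) (use A outer1 around_r in arith)+
        also have "\<dots> = p (x, Suc (Suc y - m) - l)"
          by (rule clique_comp_around) (use A outer1 around_r in arith)+
        finally have R: "?R (x, y) = p (x, Suc (Suc y - m) - l)" .
        from L R show ?thesis by simp
      qed
    next
      case outer2
      consider (before_r) "y \<le> c"
        | (around_r) "x \<le> c" "c + l \<le> y" "x \<noteq> c \<or> y \<noteq> c + l"
        | (cross_r) "x < c \<and> c < y \<and> y < c + l \<or> c < x \<and> x < c + l \<and> c + l < y"
        | (after_r) "c + l \<le> x"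
        | (inside_r) "c \<le> x" "c < y" "y \<le> c + l" "x \<noteq> c \<or> y \<noteq> c + l"
        | (graft_r) "x = c" "y = c + l"
        by atomize_elim (use A outer2 in arith)
      then show ?thesis
      proof cases
        case before_r
        have "?L (x, y) = ?pq (x, y)"
          by (rule clique_comp_before) (use A outer2 before_r in arith)+
        also have "\<dots> = p (Suc x - m, Suc y - m)"
          by (rule clique_comp_after) (use A outer2 before_r in arith)+
        finally have L: "?L (x, y) = p (Suc x - m, Suc y - m)" .
        have "?R (x, y) = ?pr (Suc x - m, Suc y - m)"
          by (rule clique_comp_after) (use A outer2 before_r in arith)+
        also have "\<dots> = p (Suc x - m, Suc y - m)"
          by (rule clique_comp_before) (use A outer2 before_r in arith)+
        finally have R: "?R (x, y) = p (Suc x - m, Suc y - m)" .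
        from L R show ?thesis by simp
      next
        case around_r
        have "?L (x, y) = ?pq (x, Suc y - l)"
          by (rule clique_comp_around) (use A outer2 around_r in arith)+
        also have "\<dots> = p (Suc x - m, Suc (Suc y - m) - l)"
          by (rule clique_comp_after) (use A outer2 around_r in arith)+
        finally have L: "?L (x, y) = p (Suc x - m, Suc (Suc y - m) - l)" .
        have "?R (x, y) = ?pr (Suc x - m, Suc y - m)"
          by (rule clique_comp_after) (use A outer2 around_r in arith)+
        also have "\<dots> = p (Suc x - m, Suc (Suc y - m) - l)"
          by (rule clique_comp_around) (use A outer2 around_r in arith)+
        finally have R: "?R (x, y) = p (Suc x - m, Suc (Suc y - m) - l)" .
        from L R show ?thesis by simp
      next
        case cross_r
        have L: "?L (x, y) = \<one>\<^bsub>M\<^esub>"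
          by (rule clique_comp_crossing) (use A outer2 cross_r in arith)+
        have "?R (x, y) = ?pr (Suc x - m, Suc y - m)"
          by (rule clique_comp_after) (use A outer2 cross_r in arith)+
        also have "\<dots> = \<one>\<^bsub>M\<^esub>"
          by (rule clique_comp_crossing) (use A outer2 cross_r in arith)+
        finally have R: "?R (x, y) = \<one>\<^bsub>M\<^esub>" .
        from L R show ?thesis by simp
      next
        case after_r
        have "?L (x, y) = ?pq (Suc x - l, Suc y - l)"
          by (rule clique_comp_after) (use A outer2 after_r in arith)+
        also have "\<dots> = p (Suc (Suc x - m) - l, Suc (Suc y - m) - l)"
          by (rule clique_comp_after) (use A outer2 after_r in arith)+
        finally have L: "?L (x, y) = p (Suc (Suc x - m) - l, Suc (Suc y - m) - l)" .
        have "?R (x, y) = ?pr (Suc x - m, Suc y - m)"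
          by (rule clique_comp_after) (use A outer2 after_r in arith)+
        also have "\<dots> = p (Suc (Suc x - m) - l, Suc (Suc y - m) - l)"
          by (rule clique_comp_after) (use A outer2 after_r in arith)+
        finally have R: "?R (x, y) = p (Suc (Suc x - m) - l, Suc (Suc y - m) - l)" .
        from L R show ?thesis by simp
      next
        case inside_r
        have L: "?L (x, y) = r (Suc x - c, Suc y - c)"
          by (rule clique_comp_inside) (use A outer2 inside_r in arith)+
        have "?R (x, y) = ?pr (Suc x - m, Suc y - m)"
          by (rule clique_comp_after) (use A outer2 inside_r in arith)+
        also have "\<dots> = r (Suc x - c, Suc y - c)"
          by (rule clique_comp_inside) (use A outer2 inside_r in arith)+
        finally have R: "?R (x, y) = r (Suc x - c, Suc y - c)" .
        from L R show ?thesis by simp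
      next
        case graft_r
        have L: "?L (x, y) = ?pq (c, Suc c) \<otimes>\<^bsub>M\<^esub> r (1, Suc l)"
          by (rule clique_comp_graft) (use A outer2 graft_r in arith)+
        have "?R (x, y) = ?pr (Suc x - m, Suc y - m)"
          by (rule clique_comp_after) (use A outer2 graft_r in arith)+
        also have "\<dots> = p (j, Suc j) \<otimes>\<^bsub>M\<^esub> r (1, Suc l)"
          by (rule clique_comp_graft) (use A outer2 graft_r in arith)+
        finally have R: "?R (x, y) = p (j, Suc j) \<otimes>\<^bsub>M\<^esub> r (1, Suc l)" .
        have "?pq (c, Suc c) = p (j, Suc j)"
          by (rule clique_comp_after) (use A outer2 graft_r in arith)+
        with L R show ?thesis by simp
      qed
    qed
  qed
  then show ?thesis by (simp add: c_def N_def L_def)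
qed

context unitary_magma
begin

lemma clique_label_closed: "\<lbrakk>p \<in> cliques M n; a \<in> arcs n\<rbrakk> \<Longrightarrow> p a \<in> carrier M"
  by (auto simp: cliques_def)

lemma clique_comp_closed:
  assumes "1 \<le> m" "1 \<le> i" "i \<le> n" "p \<in> cliques M n" "q \<in> cliques M m"
  shows "clique_comp M n m i p q \<in> cliques M (n + m - 1)"
proof -
  have p: "\<And>x y. \<lbrakk>1 \<le> x; x < y; y \<le> n + 1\<rbrakk> \<Longrightarrow> p (x, y) \<in> carrier M"
    and q: "\<And>x y. \<lbrakk>1 \<le> x; x < y; y \<le> m + 1\<rbrakk> \<Longrightarrow> q (x, y) \<in> carrier M"
    using assms by (auto intro!: clique_label_closed simp: arcs_def)
  have "clique_comp M n m i p q (x, y) \<in> carrier M" if "1 \<le> x" "x < y" "y \<le> n + m" for x y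
  proof -
    note A = assms(1-3) that
    consider
        (before) "y \<le> i"
      | (around) "x \<le> i" "i + m \<le> y" "x \<noteq> i \<or> y \<noteq> i + m"
      | (after) "i + m \<le> x"
      | (crossing) "x < i \<and> i < y \<and> y < i + m \<or> i < x \<and> x < i + m \<and> i + m < y"
      | (inside) "i \<le> x" "i < y" "y \<le> i + m" "x \<noteq> i \<or> y \<noteq> i + m"
      | (graft) "x = i" "y = i + m"
      by atomize_elim arith
    then show ?thesis
    proof cases
      case before
      then have "clique_comp M n m i p q (x, y) = p (x, y)"
        by (intro clique_comp_before) (use A before in arith)+
      also have "\<dots> \<in> carrier M"
        by (rule p) (use A before in arith)+
      finally show ?thesis .
    next
      case around
      then have "clique_comp M n m i p q (x, y) = p (x, Suc y - m)"
        by (intro clique_comp_around) (use A around in arith)+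
      also have "\<dots> \<in> carrier M"
        by (rule p) (use A around in arith)+
      finally show ?thesis .
    next
      case after
      then have "clique_comp M n m i p q (x, y) = p (Suc x - m, Suc y - m)"
        by (intro clique_comp_after) (use A after in arith)+
      also have "\<dots> \<in> carrier M"
        by (rule p) (use A after in arith)+
      finally show ?thesis .
    next
      case crossing
      then have "clique_comp M n m i p q (x, y) = \<one>"
        by (intro clique_comp_crossing) (use A crossing in arith)+
      also have "\<dots> \<in> carrier M"
        by (rule magma_one_closed)
      finally show ?thesis .
    next
      case inside
      then have "clique_comp M n m i p q (x, y) = q (Suc x - i, Suc y - i)"
        by (intro clique_comp_inside) (use A inside in arith)+
      also have "\<dots> \<in> carrier M"
        by (rule q) (use A inside in arith)+
      finally show ?thesis .
    next
      case graft
      then have "clique_comp M n m i p q (x, y) = p (i, Suc i) \<otimes> q (1, Suc m)"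
        by (intro clique_comp_graft) (use A graft in arith)+
      also have "\<dots> \<in> carrier M"
        by (intro magma_closed p q) (use A in arith)+
      finally show ?thesis .
    qed
  qed
  then have "clique_comp M n m i p q \<in> arcs (n + m - 1) \<rightarrow>\<^sub>E carrier M"
    using assms(1) by (auto simp: arcs_def clique_comp_def)
  moreover have "clique_comp M n m i p q (1, 2) = \<one>" if "n + m - 1 = 1"
  proof -
    from that assms have "n = 1" "m = 1" "i = 1" by auto
    with assms show ?thesis
      by (simp add: clique_comp_def arcs_def cliques_def magma_l_one magma_one_closed numeral_2_eq_2)
  qed
  ultimately show ?thesis
    unfolding cliques_def by simp
qed

text \<open>
  Series associativity needs no associativity of the magma. If \<open>m \<ge> 2\<close>, the arc of \<open>q\<close> that is glued
  to \<open>p\<close> (the base) differs from the arc that is glued to \<open>r\<close> (the \<open>j\<close>-th edge), so at most two labels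
  are ever multiplied. If \<open>m = 1\<close>, the two arcs coincide, but then \<open>q\<close> is the unit clique.
\<close>

lemma clique_comp_series:
  assumes "1 \<le> l" "1 \<le> i" "i \<le> n" "1 \<le> j" "j \<le> m"
    and "p \<in> cliques M n" "q \<in> cliques M m" "r \<in> cliques M l"
  shows "clique_comp M (n + m - 1) l (i + j - 1) (clique_comp M n m i p q) r
    = clique_comp M n (m + l - 1) i p (clique_comp M m l j q r)"
proof -
  \<comment> \<open>In the composite the polygon of \<open>q \<circ>\<^sub>j r\<close> occupies the interval from \<open>i\<close> to \<open>i + L\<close>, and that of \<open>r\<close>
    the subinterval from \<open>b\<close> to \<open>b + l\<close>.\<close>
  define b where "b = i + j - 1"
  define N where "N = n + m - 1"
  define L where "L = m + l - 1"
  have eqs: "Suc b = i + j" "Suc N = n + m" "Suc L = m + l"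
    using assms(1-5) by (auto simp: b_def N_def L_def)
  let ?pq = "clique_comp M n m i p q" and ?qr = "clique_comp M m l j q r"
  let ?L = "clique_comp M N l b ?pq r" and ?R = "clique_comp M n L i p ?qr"
  have "?L = ?R"
  proof (rule clique_comp_eqI)
    show "N + l = n + L" "1 \<le> l" "1 \<le> L"
      using eqs assms(1-5) by arith+
  next
    fix x y
    assume "1 \<le> x" "x < y" "y \<le> N + l"
    note A = assms(1-5) eqs this
    consider
        (before) "y \<le> i"
      | (around) "x \<le> i" "i + L \<le> y" "x \<noteq> i \<or> y \<noteq> i + L"
      | (after) "i + L \<le> x"
      | (cross1) "x < i" "i < y" "y < i + L"
      | (cross2) "i < x" "x < i + L" "i + L < y"
      | (inside) "i \<le> x" "i < y" "y \<le> i + L" "x \<noteq> i \<or> y \<noteq> i + L"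
      | (graft) "x = i" "y = i + L"
      by atomize_elim arith
    then show "?L (x, y) = ?R (x, y)"
    proof cases
      case before
      have "?L (x, y) = ?pq (x, y)"
        by (rule clique_comp_before) (use A before in arith)+
      also have "\<dots> = p (x, y)"
        by (rule clique_comp_before) (use A before in arith)+
      finally have L: "?L (x, y) = p (x, y)" .
      have R: "?R (x, y) = p (x, y)"
        by (rule clique_comp_before) (use A before in arith)+
      from L R show ?thesis by simp
    next
      case around
      have "?L (x, y) = ?pq (x, Suc y - l)"
        by (rule clique_comp_around) (use A around in arith)+
      also have "\<dots> = p (x, Suc y - L)"
        by (rule clique_comp_around) (use A around in arith)+
      finally have L: "?L (x, y) = p (x, Suc y - L)" .
      have R: "?R (x, y) = p (x, Suc y - L)"
        by (rule clique_comp_around) (use A around in arith)+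
      from L R show ?thesis by simp
    next
      case after
      have "?L (x, y) = ?pq (Suc x - l, Suc y - l)"
        by (rule clique_comp_after) (use A after in arith)+
      also have "\<dots> = p (Suc x - L, Suc y - L)"
        by (rule clique_comp_after) (use A after in arith)+
      finally have L: "?L (x, y) = p (Suc x - L, Suc y - L)" .
      have R: "?R (x, y) = p (Suc x - L, Suc y - L)"
        by (rule clique_comp_after) (use A after in arith)+
      from L R show ?thesis by simp
    next
      case cross1
      then have R: "?R (x, y) = \<one>"
        by (intro clique_comp_crossing) (use A cross1 in arith)+
      consider "y \<le> b" | "b < y" "y < b + l" | "b + l \<le> y" by linarith
      then have "?L (x, y) = \<one>"
      proof cases
        case 1
        have "?L (x, y) = ?pq (x, y)"
          by (rule clique_comp_before) (use A cross1 1 in arith)+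
        also have "\<dots> = \<one>"
          by (rule clique_comp_crossing) (use A cross1 1 in arith)+
        finally show ?thesis .
      next
        case 2
        show ?thesis
          by (rule clique_comp_crossing) (use A cross1 2 in arith)+
      next
        case 3
        have "?L (x, y) = ?pq (x, Suc y - l)"
          by (rule clique_comp_around) (use A cross1 3 in arith)+
        also have "\<dots> = \<one>"
          by (rule clique_comp_crossing) (use A cross1 3 in arith)+
        finally show ?thesis .
      qed
      with R show ?thesis by simp
    next
      case cross2
      then have R: "?R (x, y) = \<one>"
        by (intro clique_comp_crossing) (use A cross2 in arith)+
      consider "x \<le> b" | "b < x" "x < b + l" | "b + l \<le> x" by linarith
      then have "?L (x, y) = \<one>"
      proof cases
        case 1
        have "?L (x, y) = ?pq (x, Suc y - l)"
          by (rule clique_comp_around) (use A cross2 1 in arith)+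
        also have "\<dots> = \<one>"
          by (rule clique_comp_crossing) (use A cross2 1 in arith)+
        finally show ?thesis .
      next
        case 2
        show ?thesis
          by (rule clique_comp_crossing) (use A cross2 2 in arith)+
      next
        case 3
        have "?L (x, y) = ?pq (Suc x - l, Suc y - l)"
          by (rule clique_comp_after) (use A cross2 3 in arith)+
        also have "\<dots> = \<one>"
          by (rule clique_comp_crossing) (use A cross2 3 in arith)+
        finally show ?thesis .
      qed
      with R show ?thesis by simp
    next
      case inside
      consider "y \<le> b" | "x \<le> b" "b + l \<le> y" "x \<noteq> b \<or> y \<noteq> b + l" | "b + l \<le> x"
        | "x < b \<and> b < y \<and> y < b + l \<or> b < x \<and> x < b + l \<and> b + l < y"
        | "b \<le> x" "b < y" "y \<le> b + l" "x \<noteq> b \<or> y \<noteq> b + l" | "x = b" "y = b + l"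
        by atomize_elim arith
      then show ?thesis
      proof cases
        case 1
        have "?L (x, y) = ?pq (x, y)"
          by (rule clique_comp_before) (use A inside 1 in arith)+
        also have "\<dots> = q (Suc x - i, Suc y - i)"
          by (rule clique_comp_inside) (use A inside 1 in arith)+
        finally have L: "?L (x, y) = q (Suc x - i, Suc y - i)" .
        have "?R (x, y) = ?qr (Suc x - i, Suc y - i)"
          by (rule clique_comp_inside) (use A inside 1 in arith)+
        also have "\<dots> = q (Suc x - i, Suc y - i)"
          by (rule clique_comp_before) (use A inside 1 in arith)+
        finally have R: "?R (x, y) = q (Suc x - i, Suc y - i)" .
        from L R show ?thesis by simp
      next
        case 2
        have "?L (x, y) = ?pq (x, Suc y - l)"
          by (rule clique_comp_around) (use A inside 2 in arith)+
        also have "\<dots> = q (Suc x - i, Suc (Suc y - i) - l)"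
          by (rule clique_comp_inside) (use A inside 2 in arith)+
        finally have L: "?L (x, y) = q (Suc x - i, Suc (Suc y - i) - l)" .
        have "?R (x, y) = ?qr (Suc x - i, Suc y - i)"
          by (rule clique_comp_inside) (use A inside 2 in arith)+
        also have "\<dots> = q (Suc x - i, Suc (Suc y - i) - l)"
          by (rule clique_comp_around) (use A inside 2 in arith)+
        finally have R: "?R (x, y) = q (Suc x - i, Suc (Suc y - i) - l)" .
        from L R show ?thesis by simp
      next
        case 3
        have "?L (x, y) = ?pq (Suc x - l, Suc y - l)"
          by (rule clique_comp_after) (use A inside 3 in arith)+
        also have "\<dots> = q (Suc (Suc x - i) - l, Suc (Suc y - i) - l)"
          by (rule clique_comp_inside) (use A inside 3 in arith)+
        finally have L: "?L (x, y) = q (Suc (Suc x - i) - l, Suc (Suc y - i) - l)" .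
        have "?R (x, y) = ?qr (Suc x - i, Suc y - i)"
          by (rule clique_comp_inside) (use A inside 3 in arith)+
        also have "\<dots> = q (Suc (Suc x - i) - l, Suc (Suc y - i) - l)"
          by (rule clique_comp_after) (use A inside 3 in arith)+
        finally have R: "?R (x, y) = q (Suc (Suc x - i) - l, Suc (Suc y - i) - l)" .
        from L R show ?thesis by simp
      next
        case 4
        have L: "?L (x, y) = \<one>"
          by (rule clique_comp_crossing) (use A inside 4 in arith)+
        have "?R (x, y) = ?qr (Suc x - i, Suc y - i)"
          by (rule clique_comp_inside) (use A inside 4 in arith)+
        also have "\<dots> = \<one>"
          by (rule clique_comp_crossing) (use A inside 4 in arith)+
        finally have R: "?R (x, y) = \<one>" .
        from L R show ?thesis by simp
      next
        case 5
        have L: "?L (x, y) = r (Suc x - b, Suc y - b)"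
          by (rule clique_comp_inside) (use A inside 5 in arith)+
        have "?R (x, y) = ?qr (Suc x - i, Suc y - i)"
          by (rule clique_comp_inside) (use A inside 5 in arith)+
        also have "\<dots> = r (Suc x - b, Suc y - b)"
          by (rule clique_comp_inside) (use A inside 5 in arith)+
        finally have R: "?R (x, y) = r (Suc x - b, Suc y - b)" .
        from L R show ?thesis by simp
      next
        case 6
        have L: "?L (x, y) = ?pq (b, Suc b) \<otimes> r (1, Suc l)"
          by (rule clique_comp_graft) (use A inside 6 in arith)+
        have "?R (x, y) = ?qr (Suc x - i, Suc y - i)"
          by (rule clique_comp_inside) (use A inside 6 in arith)+
        also have "\<dots> = q (j, Suc j) \<otimes> r (1, Suc l)"
          by (rule clique_comp_graft) (use A inside 6 in arith)+
        finally have R: "?R (x, y) = q (j, Suc j) \<otimes> r (1, Suc l)" .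
        have "?pq (b, Suc b) = q (j, Suc j)"
          by (rule clique_comp_inside) (use A inside 6 in arith)+
        with L R show ?thesis by simp
      qed
    next
      case graft
      have R: "?R (x, y) = p (i, Suc i) \<otimes> ?qr (1, Suc L)"
        by (rule clique_comp_graft) (use A graft in arith)+
      show ?thesis
      proof (cases "m = 1")
        case True
        \<comment> \<open>Now \<open>q\<close> is the unit clique and its only arc is glued on both sides: the label would be
          a product of three labels, but the middle one is the unit of the magma.\<close>
        then have "q (1, 2) = \<one>" using assms by (auto simp: cliques_def)
        with True have q: "q (1, Suc m) = \<one>" "q (j, Suc j) = \<one>"
          using A by (simp_all add: numeral_2_eq_2)
        have c: "p (i, Suc i) \<in> carrier M" "r (1, Suc l) \<in> carrier M"
          using assms by (auto intro!: clique_label_closed simp: arcs_def)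
        have "?L (x, y) = ?pq (b, Suc b) \<otimes> r (1, Suc l)"
          by (rule clique_comp_graft) (use A graft True in arith)+
        moreover have "?pq (b, Suc b) = p (i, Suc i) \<otimes> q (1, Suc m)"
          by (rule clique_comp_graft) (use A graft True in arith)+
        moreover have "?qr (1, Suc L) = q (j, Suc j) \<otimes> r (1, Suc l)"
          by (rule clique_comp_graft) (use A graft True in arith)+
        ultimately show ?thesis using R q c by (simp add: magma_l_one magma_r_one)
      next
        case False
        have "?L (x, y) = ?pq (x, Suc y - l)"
          by (rule clique_comp_around) (use A graft False in arith)+
        also have "\<dots> = p (i, Suc i) \<otimes> q (1, Suc m)"
          by (rule clique_comp_graft) (use A graft False in arith)+
        also have "q (1, Suc m) = ?qr (1, Suc L)"
          by (rule clique_comp_around[symmetric]) (use A graft False in arith)+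
        finally show ?thesis using R by simp
      qed
    qed
  qed
  then show ?thesis by (simp add: b_def N_def L_def)
qed

lemma clique_comp_unit_left:
  assumes "1 \<le> n" "p \<in> cliques M n"
  shows "clique_comp M 1 n 1 (unit_clique M) p = p"
proof
  fix a :: "nat \<times> nat"
  show "clique_comp M 1 n 1 (unit_clique M) p a = p a"
  proof (cases "a \<in> arcs n")
    case True
    then obtain x y where a: "a = (x, y)" "1 \<le> x" "x < y" "y \<le> Suc n" by (auto simp: arcs_def)
    show ?thesis
    proof (cases "x = 1 \<and> y = Suc n")
      case False
      then show ?thesis using a assms(1)
        by (simp add: clique_comp_inside[where x' = x and y' = y])
    next
      case True
      have "p a \<in> carrier M" using assms \<open>a \<in> arcs n\<close> by (auto intro: clique_label_closed)
      with True a assms(1) show ?thesis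
        by (simp add: clique_comp_graft unit_clique_def arcs_def magma_l_one)
    qed
  next
    case False
    then have "p a = undefined" using assms by (auto simp: cliques_def)
    with False show ?thesis by (simp add: clique_comp_def)
  qed
qed

lemma clique_comp_unit_right:
  assumes "1 \<le> i" "i \<le> n" "p \<in> cliques M n"
  shows "clique_comp M n 1 i p (unit_clique M) = p"
proof
  fix a :: "nat \<times> nat"
  show "clique_comp M n 1 i p (unit_clique M) a = p a"
  proof (cases "a \<in> arcs n")
    case True
    then obtain x y where a: "a = (x, y)" "1 \<le> x" "x < y" "y \<le> Suc n" by (auto simp: arcs_def)
    consider "y \<le> i" | "i + 1 \<le> x" | "x = i" "y = i + 1"
      | "x \<le> i" "i + 1 \<le> y" "x \<noteq> i \<or> y \<noteq> i + 1" 
      by atomize_elim arith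
    then show ?thesis
    proof cases
      case 1
      then show ?thesis using a assms(1,2) by (simp add: clique_comp_before)
    next
      case 2
      then show ?thesis using a assms(1,2)
        by (simp add: clique_comp_after[where x' = x and y' = y])
    next
      case 3
      have "p a \<in> carrier M" using assms \<open>a \<in> arcs n\<close> by (auto intro: clique_label_closed)
      with 3 a assms(1,2) show ?thesis
        by (simp add: clique_comp_graft unit_clique_def arcs_def magma_r_one)
    next
      case 4
      then show ?thesis using a assms(1,2)
        by (simp add: clique_comp_around[where y' = y])
    qed
  next
    case False
    then have "p a = undefined" using assms by (auto simp: cliques_def)
    with False show ?thesis by (simp add: clique_comp_def)
  qed
qed

lemma unit_clique_closed: "unit_clique M \<in> cliques M 1"
  by (auto simp: unit_clique_def cliques_def arcs_def magma_one_closed)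

end


section \<open>Bubbles under composition\<close>

lemma not_bubble_iff:
  assumes "p \<in> cliques M n"
  shows "p \<notin> bubbles M n \<longleftrightarrow>
    (\<exists>x y. 1 \<le> x \<and> x + 1 < y \<and> y \<le> n + 1 \<and> (x, y) \<noteq> (1, n + 1) \<and> p (x, y) \<noteq> \<one>\<^bsub>M\<^esub>)"
    (is "?L \<longleftrightarrow> ?R")
proof
  assume ?L
  then obtain x y where "(x, y) \<in> diagonals n" "p (x, y) \<noteq> \<one>\<^bsub>M\<^esub>"
    using assms by (auto simp: bubbles_def)
  then show ?R
    by (intro exI[of _ x] exI[of _ y]) (auto simp: diagonals_def arcs_def)
next
  assume ?R
  then obtain x y where xy: "1 \<le> x" "x + 1 < y" "y \<le> n + 1" "(x, y) \<noteq> (1, n + 1)"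
    and "p (x, y) \<noteq> \<one>\<^bsub>M\<^esub>" by blast
  moreover have "(x, y) \<in> diagonals n"
    using xy by (simp add: diagonals_def arcs_def)
  ultimately show ?L by (auto simp: bubbles_def)
qed

text \<open>
  A solid diagonal of one of the two factors survives in the composite with its label: only the
  base of \<open>q\<close> and an edge of \<open>p\<close> take part in the gluing, and a diagonal is neither.
\<close>

lemma (in unitary_magma) clique_comp_not_bubble_right:
  assumes "1 \<le> m" "1 \<le> i" "i \<le> n" "p \<in> cliques M n" "q \<in> cliques M m - bubbles M m"
  shows "clique_comp M n m i p q \<in> cliques M (n + m - 1) - bubbles M (n + m - 1)"
proof -
  have q: "q \<in> cliques M m" using assms by simp
  obtain x y where xy: "1 \<le> x" "x + 1 < y" "y \<le> m + 1" "(x, y) \<noteq> (1, m + 1)" "q (x, y) \<noteq> \<one>"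
    using assms(5) not_bubble_iff[OF q] by auto
  have c: "clique_comp M n m i p q \<in> cliques M (n + m - 1)"
    using assms(1-4) q by (rule clique_comp_closed)
  have "clique_comp M n m i p q (x + i - 1, y + i - 1) = q (x, y)"
    by (rule clique_comp_inside) (use xy assms(1-3) in auto)
  then have "clique_comp M n m i p q \<notin> bubbles M (n + m - 1)"
    unfolding not_bubble_iff[OF c] using xy assms(1-3)
    by (intro exI[of _ "x + i - 1"] exI[of _ "y + i - 1"]) auto
  with c show ?thesis by simp
qed

lemma (in unitary_magma) clique_comp_not_bubble_left:
  assumes "1 \<le> m" "1 \<le> i" "i \<le> n" "p \<in> cliques M n - bubbles M n" "q \<in> cliques M m"
  shows "clique_comp M n m i p q \<in> cliques M (n + m - 1) - bubbles M (n + m - 1)"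
proof -
  have p: "p \<in> cliques M n" using assms by simp
  obtain x y where xy: "1 \<le> x" "x + 1 < y" "y \<le> n + 1" "(x, y) \<noteq> (1, n + 1)" "p (x, y) \<noteq> \<one>"
    using assms(4) not_bubble_iff[OF p] by auto
  have c: "clique_comp M n m i p q \<in> cliques M (n + m - 1)"
    using assms(1-3) p assms(5) by (rule clique_comp_closed)
  \<comment> \<open>the image of the arc \<open>(x, y)\<close> of \<open>p\<close> in the composite\<close>
  define x' where "x' = (if x \<le> i then x else x + m - 1)"
  define y' where "y' = (if y \<le> i then y else y + m - 1)"
  consider "y \<le> i" | "x \<le> i" "i < y" | "i < x" by linarith
  then have "clique_comp M n m i p q (x', y') = p (x, y)"
  proof cases
    case 1
    then have "x' = x" "y' = y" using xy by (auto simp: x'_def y'_def)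
    then show ?thesis using 1 xy assms(1-3) by (simp add: clique_comp_before)
  next
    case 2
    then have "x' = x" "y' = y + m - 1" by (auto simp: x'_def y'_def)
    then show ?thesis using 2 xy assms(1-3) by (intro trans[OF clique_comp_around[where y' = y]]) auto
  next
    case 3
    then have "x' = x + m - 1" "y' = y + m - 1" using xy by (auto simp: x'_def y'_def)
    then show ?thesis using 3 xy assms(1-3)
      by (intro trans[OF clique_comp_after[where x' = x and y' = y]]) auto
  qed
  moreover have "1 \<le> x'" "x' + 1 < y'" "y' \<le> n + m - 1 + 1" "(x', y') \<noteq> (1, n + m - 1 + 1)"
    using xy assms(1-3) by (auto simp: x'_def y'_def split: if_splits)
  ultimately have "clique_comp M n m i p q \<notin> bubbles M (n + m - 1)"
    unfolding not_bubble_iff[OF c] using xy(5) by (intro exI[of _ x'] exI[of _ y']) auto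
  with c show ?thesis by simp
qed


section \<open>The quotient of an operad by an ideal\<close>

lemma (in module) submodule_imp_abelian_subgroup:
  assumes "submodule N R M"
  shows "abelian_subgroup N M"
  using submodule.axioms(1)[OF assms] M.abelian_group_axioms by (rule abelian_subgroupI3[OF additive_subgroup.intro])

context
  fixes R :: "('k, 'l) ring_scheme" (structure) and M :: "('k, 'v) module" (structure) and N :: "'v set"
  assumes mod: "module R M" and sub: "submodule N R M"
begin

interpretation module R M by (rule mod)

text \<open>
  The scalar multiple of a coset is a union over its representatives. All the cosets in the union are
  equal, because their generators differ by scalar multiples of elements of the submodule.
\<close>

lemma quotient_smult_coset:
  assumes "a \<in> carrier R" "x \<in> carrier M"
  shows "a \<odot>\<^bsub>quotient_module M N\<^esub> (N +>\<^bsub>M\<^esub> x) = N +>\<^bsub>M\<^esub> (a \<odot>\<^bsub>M\<^esub> x)"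
proof -
  interpret N: abelian_subgroup N M by (rule submodule_imp_abelian_subgroup) (rule sub)
  have "N +>\<^bsub>M\<^esub> (a \<odot>\<^bsub>M\<^esub> x') = N +>\<^bsub>M\<^esub> (a \<odot>\<^bsub>M\<^esub> x)" if "x' \<in> N +>\<^bsub>M\<^esub> x" for x'
  proof -
    from that obtain h where h: "h \<in> N" "x' = h \<oplus>\<^bsub>M\<^esub> x" by (auto simp: a_r_coset_def')
    have "a \<odot>\<^bsub>M\<^esub> x' = a \<odot>\<^bsub>M\<^esub> h \<oplus>\<^bsub>M\<^esub> a \<odot>\<^bsub>M\<^esub> x" using h assms by (simp add: smult_r_distr)
    moreover have "a \<odot>\<^bsub>M\<^esub> h \<in> N" using h assms sub submoduleE(4) by blast
    ultimately have "a \<odot>\<^bsub>M\<^esub> x' \<in> N +>\<^bsub>M\<^esub> (a \<odot>\<^bsub>M\<^esub> x)" by (auto simp: a_r_coset_def')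
    then show ?thesis using assms by (intro N.a_repr_independence'[symmetric]) auto
  qed
  moreover have "x \<in> N +>\<^bsub>M\<^esub> x" using assms by (intro N.a_rcos_self) 
  ultimately have "(\<Union>x'\<in>N +>\<^bsub>M\<^esub> x. N +>\<^bsub>M\<^esub> (a \<odot>\<^bsub>M\<^esub> x')) = N +>\<^bsub>M\<^esub> (a \<odot>\<^bsub>M\<^esub> x)"
    by blast
  then show ?thesis by (simp add: quotient_module_def)
qed

lemma quotient_carrier: "carrier (quotient_module M N) = (\<lambda>x. N +>\<^bsub>M\<^esub> x) ` carrier M"
  by (auto simp: quotient_module_def A_RCOSETS_def')

lemma quotient_add_coset:
  assumes "x \<in> carrier M" "y \<in> carrier M"
  shows "(N +>\<^bsub>M\<^esub> x) \<oplus>\<^bsub>quotient_module M N\<^esub> (N +>\<^bsub>M\<^esub> y) = N +>\<^bsub>M\<^esub> (x \<oplus>\<^bsub>M\<^esub> y)"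
proof -
  interpret N: abelian_subgroup N M by (rule submodule_imp_abelian_subgroup) (rule sub)
  show ?thesis using assms by (simp add: quotient_module_def N.a_rcos_sum)
qed

lemma module_quotient_module:
  shows "module R (quotient_module M N)"
proof -
  interpret N: abelian_subgroup N M by (rule submodule_imp_abelian_subgroup) (rule sub)
  note [simp] = quotient_smult_coset quotient_add_coset
  have z: "\<zero>\<^bsub>quotient_module M N\<^esub> = N +>\<^bsub>M\<^esub> \<zero>\<^bsub>M\<^esub>"
    by (simp add: quotient_module_def N.a_rcos_const)
  show ?thesis
  proof (rule moduleI)
    show "cring R" ..
    show "abelian_group (quotient_module M N)"
    proof (rule abelian_groupI)
      fix X assume "X \<in> carrier (quotient_module M N)"
      then obtain x where "x \<in> carrier M" "X = N +>\<^bsub>M\<^esub> x" by (auto simp: quotient_carrier)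
      then have "(N +>\<^bsub>M\<^esub> (\<ominus>\<^bsub>M\<^esub> x)) \<oplus>\<^bsub>quotient_module M N\<^esub> X = \<zero>\<^bsub>quotient_module M N\<^esub>" "\<ominus>\<^bsub>M\<^esub> x \<in> carrier M"
        by (simp_all add: z M.l_neg)
      then show "\<exists>Y\<in>carrier (quotient_module M N). Y \<oplus>\<^bsub>quotient_module M N\<^esub> X = \<zero>\<^bsub>quotient_module M N\<^esub>"
        unfolding quotient_carrier by blast
    qed (auto simp: quotient_carrier z M.a_ac)
  qed (auto simp: quotient_carrier smult_l_distr smult_r_distr smult_assoc1)
qed

end

context operad_ideal
begin

text \<open>The coset of an element of arity \<open>n\<close> modulo the ideal.\<close>

abbreviation coset :: "nat \<Rightarrow> 'v \<Rightarrow> 'v set" where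
  "coset n x \<equiv> I n +>\<^bsub>component P n\<^esub> x"

lemma ideal_subset: "\<lbrakk>1 \<le> n; x \<in> I n\<rbrakk> \<Longrightarrow> x \<in> carrier (component P n)"
  using module.submoduleE(1)[OF component_module ideal_submodule] by blast

text \<open>
  The composition of the quotient is well defined: if \<open>h\<close> and \<open>k\<close> lie in the ideal, then
  \<open>(h + x) \<circ>\<^sub>i y' = h \<circ>\<^sub>i y' + x \<circ>\<^sub>i k + x \<circ>\<^sub>i y\<close> for \<open>y' = k + y\<close>, and the first two summands are in the ideal.
\<close>

lemma pcomp_coset:
  assumes "1 \<le> m" "1 \<le> i" "i \<le> n"
    and x: "x \<in> carrier (component P n)" and y: "y \<in> carrier (component P m)"
  shows "pcomp (quotient_operad P I) n m i (coset n x) (coset m y)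
    = coset (n + m - 1) (pcomp P n m i x y)"
proof -
  have n: "1 \<le> n" "1 \<le> n + m - 1" using assms by auto
  interpret Vn: module K "component P n" using n by (intro component_module)
  interpret Vm: module K "component P m" using assms by (intro component_module)
  interpret V: module K "component P (n + m - 1)" using n by (intro component_module)
  interpret In: abelian_subgroup "I n" "component P n"
    using n by (intro Vn.submodule_imp_abelian_subgroup ideal_submodule)
  interpret Im: abelian_subgroup "I m" "component P m"
    using assms by (intro Vm.submodule_imp_abelian_subgroup ideal_submodule)
  interpret J: abelian_subgroup "I (n + m - 1)" "component P (n + m - 1)"
    using n by (intro V.submodule_imp_abelian_subgroup ideal_submodule)
  note pc = pcomp_closed[OF assms(1-3)]
  have "coset (n + m - 1) (pcomp P n m i x' y') = coset (n + m - 1) (pcomp P n m i x y)"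
    if "x' \<in> coset n x" "y' \<in> coset m y" for x' y'
  proof -
    from that obtain h k where h: "h \<in> I n" "x' = h \<oplus>\<^bsub>component P n\<^esub> x"
      and k: "k \<in> I m" "y' = k \<oplus>\<^bsub>component P m\<^esub> y" by (auto simp: a_r_coset_def')
    have hk: "h \<in> carrier (component P n)" "k \<in> carrier (component P m)" "y' \<in> carrier (component P m)"
      using h k assms n y by (auto intro: ideal_subset)
    have 1: "pcomp P n m i h y' \<in> I (n + m - 1)"
      using assms n h hk by (intro ideal_left)
    have 2: "pcomp P n m i x k \<in> I (n + m - 1)"
      using assms k x by (intro ideal_right)
    have "pcomp P n m i x' y' = pcomp P n m i h y' \<oplus>\<^bsub>component P (n + m - 1)\<^esub> pcomp P n m i x y'"
      using assms hk h x by (simp add: pcomp_add_left)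
    also have "pcomp P n m i x y' = pcomp P n m i x k \<oplus>\<^bsub>component P (n + m - 1)\<^esub> pcomp P n m i x y"
      using assms hk k x y by (simp add: pcomp_add_right)
    finally have "pcomp P n m i x' y' = (pcomp P n m i h y' \<oplus>\<^bsub>component P (n + m - 1)\<^esub> pcomp P n m i x k)
        \<oplus>\<^bsub>component P (n + m - 1)\<^esub> pcomp P n m i x y"
      using pc hk x y by (simp add: V.M.a_assoc del: One_nat_def)
    then have "pcomp P n m i x' y' \<in> coset (n + m - 1) (pcomp P n m i x y)"
      using J.a_closed[OF 1 2] by (auto simp: a_r_coset_def')
    then show ?thesis using pc x y by (intro J.a_repr_independence'[symmetric]) auto
  qed
  moreover have "x \<in> coset n x" "y \<in> coset m y"
    using x y by (auto intro: In.a_rcos_self Im.a_rcos_self)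
  ultimately have "(\<Union>x'\<in>coset n x. \<Union>y'\<in>coset m y. coset (n + m - 1) (pcomp P n m i x' y'))
      = coset (n + m - 1) (pcomp P n m i x y)"
    by blast
  then show ?thesis by (simp add: quotient_operad_def)
qed

lemma quotient_component_carrier:
  "1 \<le> n \<Longrightarrow> carrier (component (quotient_operad P I) n) = coset n ` carrier (component P n)"
  using quotient_carrier[OF component_module ideal_submodule] by (simp add: quotient_operad_def)

lemma quotient_component_add:
  "\<lbrakk>1 \<le> n; x \<in> carrier (component P n); y \<in> carrier (component P n)\<rbrakk> \<Longrightarrow>
    coset n x \<oplus>\<^bsub>component (quotient_operad P I) n\<^esub> coset n y = coset n (x \<oplus>\<^bsub>component P n\<^esub> y)"
  using quotient_add_coset[OF component_module ideal_submodule] by (simp add: quotient_operad_def)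

lemma quotient_component_smult:
  "\<lbrakk>1 \<le> n; a \<in> carrier K; x \<in> carrier (component P n)\<rbrakk> \<Longrightarrow>
    a \<odot>\<^bsub>component (quotient_operad P I) n\<^esub> coset n x = coset n (a \<odot>\<^bsub>component P n\<^esub> x)"
  using quotient_smult_coset[OF component_module ideal_submodule] by (simp add: quotient_operad_def)

theorem quotient_operad: "ns_operad K (quotient_operad P I)" (is "ns_operad K ?Q")
proof -
  have coset_ex: "\<exists>x. x \<in> carrier (component P n) \<and> X = coset n x"
    if "X \<in> carrier (component ?Q n)" "1 \<le> n" for X n
    using that by (auto simp: quotient_component_carrier)
  have add: "x \<oplus>\<^bsub>component P n\<^esub> x' \<in> carrier (component P n)"
    if "1 \<le> n" "x \<in> carrier (component P n)" "x' \<in> carrier (component P n)" for n x x'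
    using that abelian_groupE(1)[OF module.axioms(2)[OF component_module]] by blast
  have smult: "a \<odot>\<^bsub>component P n\<^esub> x \<in> carrier (component P n)"
    if "1 \<le> n" "a \<in> carrier K" "x \<in> carrier (component P n)" for n x a
    using that module.smult_closed[OF component_module] by blast
  note rules = pcomp_coset quotient_component_add quotient_component_smult pcomp_closed add smult
  show ?thesis
  proof (intro ns_operad.intro ns_operad_axioms.intro)
    show "field K" by (rule K.field_axioms)
    show "module K (component ?Q n)" if "1 \<le> n" for n
      using module_quotient_module[OF component_module[OF that] ideal_submodule[OF that]]
      by (simp add: quotient_operad_def)
    show "pcomp ?Q n m i X Y \<in> carrier (component ?Q (n + m - 1))"
      if "1 \<le> m" "1 \<le> i" "i \<le> n" "X \<in> carrier (component ?Q n)" "Y \<in> carrier (component ?Q m)"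
      for n m i X Y
    proof -
      note hyps = that
      have n: "1 \<le> n" "1 \<le> n + m - 1" using that by auto
      obtain x y where "x \<in> carrier (component P n)" "X = coset n x"
        "y \<in> carrier (component P m)" "Y = coset m y" using coset_ex hyps n by meson
      with that n show ?thesis by (simp add: rules quotient_component_carrier del: One_nat_def)
    qed
    show "pcomp ?Q n m i (X \<oplus>\<^bsub>component ?Q n\<^esub> X') Y
        = pcomp ?Q n m i X Y \<oplus>\<^bsub>component ?Q (n + m - 1)\<^esub> pcomp ?Q n m i X' Y"
      if "1 \<le> m" "1 \<le> i" "i \<le> n" "X \<in> carrier (component ?Q n)" "X' \<in> carrier (component ?Q n)"
        "Y \<in> carrier (component ?Q m)" for n m i X X' Y
    proof -
      note hyps = that
      have n: "1 \<le> n" "1 \<le> n + m - 1" using that by auto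
      obtain x x' y where "x \<in> carrier (component P n)" "X = coset n x"
        "x' \<in> carrier (component P n)" "X' = coset n x'"
        "y \<in> carrier (component P m)" "Y = coset m y" using coset_ex hyps n by meson
      with that n show ?thesis by (simp add: rules pcomp_add_left del: One_nat_def)
    qed
    show "pcomp ?Q n m i X (Y \<oplus>\<^bsub>component ?Q m\<^esub> Y')
        = pcomp ?Q n m i X Y \<oplus>\<^bsub>component ?Q (n + m - 1)\<^esub> pcomp ?Q n m i X Y'"
      if "1 \<le> m" "1 \<le> i" "i \<le> n" "X \<in> carrier (component ?Q n)" "Y \<in> carrier (component ?Q m)"
        "Y' \<in> carrier (component ?Q m)" for n m i X Y Y'
    proof -
      note hyps = that
      have n: "1 \<le> n" "1 \<le> n + m - 1" using that by auto
      obtain x y y' where "x \<in> carrier (component P n)" "X = coset n x"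
        "y \<in> carrier (component P m)" "Y = coset m y"
        "y' \<in> carrier (component P m)" "Y' = coset m y'" using coset_ex hyps n by meson
      with that n show ?thesis by (simp add: rules pcomp_add_right del: One_nat_def)
    qed
    show "pcomp ?Q n m i (a \<odot>\<^bsub>component ?Q n\<^esub> X) Y = a \<odot>\<^bsub>component ?Q (n + m - 1)\<^esub> pcomp ?Q n m i X Y"
      if "1 \<le> m" "1 \<le> i" "i \<le> n" "a \<in> carrier K" "X \<in> carrier (component ?Q n)"
        "Y \<in> carrier (component ?Q m)" for n m i a X Y
    proof -
      note hyps = that
      have n: "1 \<le> n" "1 \<le> n + m - 1" using that by auto
      obtain x y where "x \<in> carrier (component P n)" "X = coset n x"
        "y \<in> carrier (component P m)" "Y = coset m y" using coset_ex hyps n by meson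
      with that n show ?thesis by (simp add: rules pcomp_smult_left del: One_nat_def)
    qed
    show "pcomp ?Q n m i X (a \<odot>\<^bsub>component ?Q m\<^esub> Y) = a \<odot>\<^bsub>component ?Q (n + m - 1)\<^esub> pcomp ?Q n m i X Y"
      if "1 \<le> m" "1 \<le> i" "i \<le> n" "a \<in> carrier K" "X \<in> carrier (component ?Q n)"
        "Y \<in> carrier (component ?Q m)" for n m i a X Y
    proof -
      note hyps = that
      have n: "1 \<le> n" "1 \<le> n + m - 1" using that by auto
      obtain x y where "x \<in> carrier (component P n)" "X = coset n x"
        "y \<in> carrier (component P m)" "Y = coset m y" using coset_ex hyps n by meson
      with that n show ?thesis by (simp add: rules pcomp_smult_right del: One_nat_def)
    qed
    show "pcomp ?Q (n + m - 1) l (i + j - 1) (pcomp ?Q n m i X Y) Z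
        = pcomp ?Q n (m + l - 1) i X (pcomp ?Q m l j Y Z)"
      if "1 \<le> l" "1 \<le> i" "i \<le> n" "1 \<le> j" "j \<le> m" "X \<in> carrier (component ?Q n)"
        "Y \<in> carrier (component ?Q m)" "Z \<in> carrier (component ?Q l)" for n m l i j X Y Z
    proof -
      note hyps = that
      have n: "1 \<le> n" "1 \<le> m" "1 \<le> n + m - 1" "1 \<le> m + l - 1" "1 \<le> i + j - 1" "i + j - 1 \<le> n + m - 1"
        and ar: "n + m - 1 + l - 1 = n + (m + l - 1) - 1" using that by auto
      obtain x y z where xyz: "x \<in> carrier (component P n)" "X = coset n x"
        "y \<in> carrier (component P m)" "Y = coset m y"
        "z \<in> carrier (component P l)" "Z = coset l z" using coset_ex hyps n by meson
      have "pcomp P n m i x y \<in> carrier (component P (n + m - 1))"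
        "pcomp P m l j y z \<in> carrier (component P (m + l - 1))"
        using that n xyz by (simp_all add: pcomp_closed del: One_nat_def)
      with that n xyz show ?thesis
        using series_assoc[OF that(1-5) xyz(1,3,5)] ar by (simp add: pcomp_coset del: One_nat_def)
    qed
    show "pcomp ?Q (n + m - 1) l (j + m - 1) (pcomp ?Q n m i X Y) Z
        = pcomp ?Q (n + l - 1) m i (pcomp ?Q n l j X Z) Y"
      if "1 \<le> m" "1 \<le> l" "1 \<le> i" "i < j" "j \<le> n" "X \<in> carrier (component ?Q n)"
        "Y \<in> carrier (component ?Q m)" "Z \<in> carrier (component ?Q l)" for n m l i j X Y Z
    proof -
      note hyps = that
      have n: "1 \<le> n" "1 \<le> j" "i \<le> n" "i \<le> n + l - 1" "1 \<le> j + m - 1" "j + m - 1 \<le> n + m - 1"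
        and ar: "n + m - 1 + l - 1 = n + l - 1 + m - 1" using that by auto
      obtain x y z where xyz: "x \<in> carrier (component P n)" "X = coset n x"
        "y \<in> carrier (component P m)" "Y = coset m y"
        "z \<in> carrier (component P l)" "Z = coset l z" using coset_ex hyps n by meson
      have "pcomp P n m i x y \<in> carrier (component P (n + m - 1))"
        "pcomp P n l j x z \<in> carrier (component P (n + l - 1))"
        using that n xyz by (simp_all add: pcomp_closed del: One_nat_def)
      with that n xyz show ?thesis
        using parallel_assoc[OF that(1-5) xyz(1,3,5)] ar by (simp add: pcomp_coset del: One_nat_def)
    qed
    show "operad_unit ?Q \<in> carrier (component ?Q 1)"
      using unit_closed by (simp add: quotient_component_carrier) (simp add: quotient_operad_def)
    have unit: "operad_unit ?Q = coset 1 (operad_unit P)" by (simp add: quotient_operad_def)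
    show "pcomp ?Q 1 n 1 (operad_unit ?Q) X = X" if "1 \<le> n" "X \<in> carrier (component ?Q n)" for n X
    proof -
      note hyps = that
      obtain x where "x \<in> carrier (component P n)" "X = coset n x" using coset_ex hyps by meson
      with that show ?thesis
        using pcomp_coset[OF that(1) order_refl order_refl unit_closed] by (simp add: unit unit_left del: One_nat_def)
    qed
    show "pcomp ?Q n 1 i X (operad_unit ?Q) = X"
      if "1 \<le> i" "i \<le> n" "X \<in> carrier (component ?Q n)" for n i X
    proof -
      note hyps = that
      have "1 \<le> n" using that by simp
      then obtain x where "x \<in> carrier (component P n)" "X = coset n x" using coset_ex hyps by meson
      with that show ?thesis
        using pcomp_coset[OF order_refl that(1,2) _ unit_closed] by (simp add: unit unit_right del: One_nat_def)
    qed
  qed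
qed

end


section \<open>Linear maps and spans\<close>

lemma module_span_submodule:
  assumes "module K V" "S \<subseteq> carrier V"
  shows "submodule (module_span K V S) K V"
proof -
  interpret module K V by fact
  have c: "carrier V \<in> {N. submodule N K V \<and> S \<subseteq> N}"
    using assms(2) carrier_is_submodule by simp
  show ?thesis unfolding module_span_def
  proof (rule submoduleI)
    show "\<zero>\<^bsub>V\<^esub> \<in> \<Inter> {N. submodule N K V \<and> S \<subseteq> N}"
      using subgroup.one_closed[OF submodule.axioms(1)] by fastforce
  qed (use c submoduleE in auto)
qed

lemma module_span_superset: "S \<subseteq> module_span K V S"
  by (auto simp: module_span_def)

lemma module_span_least: "\<lbrakk>submodule N K V; S \<subseteq> N\<rbrakk> \<Longrightarrow> module_span K V S \<subseteq> N"
  by (auto simp: module_span_def)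

text \<open>
  Homomorphisms of modules. Only the values on the carrier of the source are constrained, so that two
  homomorphisms that agree there need not be equal as functions.
\<close>

definition linear_maps ::
    "('k, 'l) ring_scheme \<Rightarrow> ('k, 'v) module \<Rightarrow> ('k, 'w) module \<Rightarrow> ('v \<Rightarrow> 'w) set" where
  "linear_maps K V W = {F \<in> carrier V \<rightarrow> carrier W.
     (\<forall>x\<in>carrier V. \<forall>y\<in>carrier V. F (x \<oplus>\<^bsub>V\<^esub> y) = F x \<oplus>\<^bsub>W\<^esub> F y) \<and>
     (\<forall>a\<in>carrier K. \<forall>x\<in>carrier V. F (a \<odot>\<^bsub>V\<^esub> x) = a \<odot>\<^bsub>W\<^esub> F x)}"

lemma linear_maps_comp:
  "\<lbrakk>F \<in> linear_maps K U V; G \<in> linear_maps K V W\<rbrakk> \<Longrightarrow> (\<lambda>x. G (F x)) \<in> linear_maps K U W"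
  unfolding linear_maps_def by (auto simp: Pi_iff)

context
  fixes K :: "('k, 'l) ring_scheme" (structure) and V :: "('k, 'v) module" and W :: "('k, 'w) module"
  assumes V: "module K V" and W: "module K W"
begin

interpretation V: module K V by (rule V)
interpretation W: module K W by (rule W)

lemma linear_map_zero: 
  assumes "F \<in> linear_maps K V W" 
  shows "F \<zero>\<^bsub>V\<^esub> = \<zero>\<^bsub>W\<^esub>"
proof -
  have "F (\<zero> \<odot>\<^bsub>V\<^esub> \<zero>\<^bsub>V\<^esub>) = \<zero> \<odot>\<^bsub>W\<^esub> F \<zero>\<^bsub>V\<^esub>" "F \<zero>\<^bsub>V\<^esub> \<in> carrier W"
    using assms by (auto simp: linear_maps_def simp del: V.smult_l_null V.smult_r_null)
  then show ?thesis by simp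
qed

lemma linear_map_neg:
  assumes "F \<in> linear_maps K V W" "x \<in> carrier V"
  shows "F (\<ominus>\<^bsub>V\<^esub> x) = \<ominus>\<^bsub>W\<^esub> F x"
proof -
  have "F ((\<ominus> \<one>) \<odot>\<^bsub>V\<^esub> x) = (\<ominus> \<one>) \<odot>\<^bsub>W\<^esub> F x" "F x \<in> carrier W"
    using assms by (auto simp: linear_maps_def)
  then show ?thesis using assms by (simp add: V.smult_l_minus W.smult_l_minus)
qed

lemma linear_map_span:
  assumes F: "F \<in> linear_maps K V W" and N: "submodule N K W"
    and S: "S \<subseteq> carrier V" "\<And>s. s \<in> S \<Longrightarrow> F s \<in> N" and x: "x \<in> module_span K V S"
  shows "F x \<in> N"
proof -
  have "submodule {x \<in> carrier V. F x \<in> N} K V"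
  proof (rule V.submoduleI)
    show "\<zero>\<^bsub>V\<^esub> \<in> {x \<in> carrier V. F x \<in> N}"
      using linear_map_zero[OF F] subgroup.one_closed[OF submodule.axioms(1)[OF N]] by simp
  qed (use F linear_map_neg[OF F] W.submoduleE[OF N] in \<open>auto simp: linear_maps_def\<close>)
  from module_span_least[OF this, of S] S x show ?thesis by auto
qed

lemma linear_map_eq_on_span:
  assumes F: "F \<in> linear_maps K V W" and G: "G \<in> linear_maps K V W"
    and S: "S \<subseteq> carrier V" "\<And>s. s \<in> S \<Longrightarrow> F s = G s" and x: "x \<in> module_span K V S"
  shows "F x = G x"
proof -
  have "submodule {x \<in> carrier V. F x = G x} K V"
  proof (rule V.submoduleI)
    show "\<zero>\<^bsub>V\<^esub> \<in> {x \<in> carrier V. F x = G x}"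
      using linear_map_zero[OF F] linear_map_zero[OF G] by simp
  qed (use F G linear_map_neg[OF F] linear_map_neg[OF G] in \<open>auto simp: linear_maps_def\<close>)
  from module_span_least[OF this, of S] S x show ?thesis by auto
qed

end


section \<open>The clique operad\<close>

text \<open>
  A field of coefficients together with a unitary magma of labels. Unannotated operations are those
  of the field.
\<close>

locale linear_cliques = K?: field K + unitary_magma M
  for K :: "('k, 'l) ring_scheme" (structure) and M :: "('a, 'm) monoid_scheme"
begin

text \<open>The space of arity \<open>n\<close> and the partial compositions of the clique operad.\<close>

abbreviation CM :: "nat \<Rightarrow> ('k, (nat \<times> nat \<Rightarrow> 'a) \<Rightarrow> 'k) module" where
  "CM n \<equiv> clique_space K M n"

abbreviation compose :: "nat \<Rightarrow> nat \<Rightarrow> nat \<Rightarrow> ((nat \<times> nat \<Rightarrow> 'a) \<Rightarrow> 'k) \<Rightarrow> ((nat \<times> nat \<Rightarrow> 'a) \<Rightarrow> 'k)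
    \<Rightarrow> (nat \<times> nat \<Rightarrow> 'a) \<Rightarrow> 'k" where
  "compose \<equiv> pcomp (clique_operad K M)"

lemma clique_spaceI:
  "\<lbrakk>\<And>p. f p \<in> carrier K; finite A; \<And>p. f p \<noteq> \<zero> \<Longrightarrow> p \<in> A; \<And>p. f p \<noteq> \<zero> \<Longrightarrow> p \<in> cliques M n\<rbrakk>
    \<Longrightarrow> f \<in> carrier (CM n)"
  by (auto simp: clique_space_def intro: finite_subset)

lemma clique_spaceD:
  assumes "f \<in> carrier (CM n)"
  shows "f p \<in> carrier K" "finite {p. f p \<noteq> \<zero>}" "f p \<noteq> \<zero> \<Longrightarrow> p \<in> cliques M n"
  using assms by (auto simp: clique_space_def)

lemma clique_space_simps:
  "\<zero>\<^bsub>CM n\<^esub> = (\<lambda>p. \<zero>)" "f \<oplus>\<^bsub>CM n\<^esub> g = (\<lambda>p. f p \<oplus> g p)" "a \<odot>\<^bsub>CM n\<^esub> f = (\<lambda>p. a \<otimes> f p)"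
  by (simp_all add: clique_space_def)

lemma clique_space_module: "module K (CM n)"
proof -
  have add: "(\<lambda>p. f p \<oplus> g p) \<in> carrier (CM n)" if "f \<in> carrier (CM n)" "g \<in> carrier (CM n)" for f g
  proof (rule clique_spaceI)
    show "finite ({p. f p \<noteq> \<zero>} \<union> {p. g p \<noteq> \<zero>})" using that clique_spaceD(2) by auto
    show "p \<in> {p. f p \<noteq> \<zero>} \<union> {p. g p \<noteq> \<zero>}" "p \<in> cliques M n" if "f p \<oplus> g p \<noteq> \<zero>" for p
      using that clique_spaceD(3)[OF \<open>f \<in> carrier (CM n)\<close>] clique_spaceD(3)[OF \<open>g \<in> carrier (CM n)\<close>] 
      by (cases "f p = \<zero>"; cases "g p = \<zero>"; simp)+
  qed (use that clique_spaceD(1) in auto)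
  have smult: "(\<lambda>p. a \<otimes> f p) \<in> carrier (CM n)" if "a \<in> carrier K" "f \<in> carrier (CM n)" for a f
  proof -
    have "f p \<noteq> \<zero>" if "a \<otimes> f p \<noteq> \<zero>" for p
      using that \<open>a \<in> carrier K\<close> by auto
    then show ?thesis
      by (intro clique_spaceI[where A = "{p. f p \<noteq> \<zero>}"])
        (use that clique_spaceD[OF \<open>f \<in> carrier (CM n)\<close>] in auto)
  qed
  show ?thesis
  proof (rule moduleI)
    show "cring K" ..
    show "abelian_group (CM n)"
    proof (rule abelian_groupI)
      show "\<zero>\<^bsub>CM n\<^esub> \<in> carrier (CM n)" by (auto simp: clique_space_simps intro: clique_spaceI)
      fix f assume f: "f \<in> carrier (CM n)"
      show "\<exists>g\<in>carrier (CM n). g \<oplus>\<^bsub>CM n\<^esub> f = \<zero>\<^bsub>CM n\<^esub>"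
        using f clique_spaceD(1)[OF f] smult[of "\<ominus> \<one>" f]
        by (intro bexI[of _ "\<lambda>p. (\<ominus> \<one>) \<otimes> f p"]) (auto simp: clique_space_simps K.l_minus K.l_neg)
    qed (use clique_spaceD(1) add in \<open>auto simp: clique_space_simps K.a_ac fun_eq_iff\<close>)
  qed (use clique_spaceD(1) smult in \<open>auto simp: clique_space_simps K.l_distr K.r_distr K.m_assoc fun_eq_iff\<close>)
qed

lemma clique_basis_closed: "p \<in> cliques M n \<Longrightarrow> clique_basis K p \<in> carrier (CM n)"
  by (rule clique_spaceI[where A = "{p}"]) (auto simp: clique_basis_def split: if_splits)

lemma support_in_basis_span:
  assumes f: "f \<in> carrier (CM n)" and supp: "{p. f p \<noteq> \<zero>} \<subseteq> S"
  shows "f \<in> module_span K (CM n) (clique_basis K ` S)"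
proof -
  interpret V: module K "CM n" by (rule clique_space_module)
  have "f \<in> N" if N: "submodule N K (CM n)" "clique_basis K ` S \<subseteq> N" for N
  proof -
    have "\<forall>f\<in>carrier (CM n). {p. f p \<noteq> \<zero>} \<subseteq> A \<longrightarrow> f \<in> N" if "finite A" "A \<subseteq> S" for A
      using that
    proof induction
      case empty
      have "f = \<zero>\<^bsub>CM n\<^esub>" if "{p. f p \<noteq> \<zero>} \<subseteq> {}" for f
        using that by (auto simp: clique_space_simps)
      then show ?case using subgroup.one_closed[OF submodule.axioms(1)[OF N(1)]] by auto
    next
      case (insert p A)
      show ?case
      proof (intro ballI impI)
        fix f assume f: "f \<in> carrier (CM n)" "{q. f q \<noteq> \<zero>} \<subseteq> insert p A"
        define g where "g = f(p := \<zero>)"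
        have "g \<in> carrier (CM n)"
          by (rule clique_spaceI[where A = "{q. f q \<noteq> \<zero>}"])
            (use clique_spaceD[OF f(1)] in \<open>auto simp: g_def split: if_splits\<close>)
        moreover have "{q. g q \<noteq> \<zero>} \<subseteq> A" using f by (auto simp: g_def)
        ultimately have "g \<in> N" using insert by blast
        moreover have "clique_basis K p \<in> N" using N(2) insert.prems by auto
        moreover have "f = g \<oplus>\<^bsub>CM n\<^esub> f p \<odot>\<^bsub>CM n\<^esub> clique_basis K p"
          using clique_spaceD(1)[OF f(1)] by (auto simp: clique_space_simps g_def clique_basis_def)
        ultimately show "f \<in> N"
          using V.submoduleE(4,5)[OF N(1)] clique_spaceD(1)[OF f(1)] by metis
      qed
    qed
    from this[OF clique_spaceD(2)[OF f] supp] f show ?thesis by blast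
  qed
  then show ?thesis by (auto simp: module_span_def)
qed

lemma clique_space_span: "f \<in> carrier (CM n) \<Longrightarrow> f \<in> module_span K (CM n) (clique_basis K ` cliques M n)"
  using clique_spaceD(3) by (intro support_in_basis_span) auto

text \<open>
  The index set of the sum that defines a composition depends on the supports of both factors. Summing
  over any finite rectangle that contains the supports makes bilinearity accessible.
\<close>

lemma compose_eq_finsum:
  assumes "f \<in> carrier (CM n)" "g \<in> carrier (CM m)"
    and "finite A" "finite B" "{p. f p \<noteq> \<zero>} \<subseteq> A" "{q. g q \<noteq> \<zero>} \<subseteq> B"
  shows "compose n m i f g r
    = (\<Oplus>c\<in>A \<times> B. if clique_comp M n m i (fst c) (snd c) = r then f (fst c) \<otimes> g (snd c) else \<zero>)"
  unfolding clique_operad_def ns_operad.simps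
proof (rule K.add.finprod_mono_neutral_cong_left)
  fix c assume "c \<in> A \<times> B - {(p, q). f p \<noteq> \<zero> \<and> g q \<noteq> \<zero> \<and> clique_comp M n m i p q = r}"
  then show "(if clique_comp M n m i (fst c) (snd c) = r then f (fst c) \<otimes> g (snd c) else \<zero>) = \<zero>"
    using clique_spaceD(1)[OF assms(1)] clique_spaceD(1)[OF assms(2)] by (cases c) auto
qed (use assms clique_spaceD(1) in auto)

lemma compose_closed:
  assumes "1 \<le> m" "1 \<le> i" "i \<le> n" "f \<in> carrier (CM n)" "g \<in> carrier (CM m)"
  shows "compose n m i f g \<in> carrier (CM (n + m - 1))"
proof (rule clique_spaceI)
  let ?A = "{p. f p \<noteq> \<zero>}" and ?B = "{p. g p \<noteq> \<zero>}"
  have fin: "finite ?A" "finite ?B" using assms clique_spaceD(2) by auto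
  note sum = compose_eq_finsum[OF assms(4,5) fin order_refl order_refl]
  show "compose n m i f g r \<in> carrier K" for r
    unfolding sum by (rule K.finsum_closed) (use assms clique_spaceD(1) in auto)
  show "finite ((\<lambda>c. clique_comp M n m i (fst c) (snd c)) ` (?A \<times> ?B))" using fin by simp
  have ex: "\<exists>c\<in>?A \<times> ?B. clique_comp M n m i (fst c) (snd c) = r" if "compose n m i f g r \<noteq> \<zero>" for r
  proof (rule ccontr)
    assume neg: "\<not> ?thesis"
    have "clique_comp M n m i (fst c) (snd c) \<noteq> r" if "c \<in> ?A \<times> ?B" for c
      using neg that by blast
    then have "compose n m i f g r = (\<Oplus>c\<in>?A \<times> ?B. \<zero>)"
      unfolding sum by (intro K.finsum_cong') auto
    with that show False by simp
  qed
  then show "r \<in> (\<lambda>c. clique_comp M n m i (fst c) (snd c)) ` (?A \<times> ?B)"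
    if "compose n m i f g r \<noteq> \<zero>" for r using that by fastforce
  show "r \<in> cliques M (n + m - 1)" if "compose n m i f g r \<noteq> \<zero>" for r
    using ex[OF that] clique_comp_closed[OF assms(1-3)] assms clique_spaceD(3) by auto
qed

lemma compose_basis:
  assumes "p \<in> cliques M n" "q \<in> cliques M m"
  shows "compose n m i (clique_basis K p) (clique_basis K q) = clique_basis K (clique_comp M n m i p q)"
proof
  fix r
  have fin: "finite {p}" "finite {q}" by auto
  have supp: "{p'. clique_basis K p p' \<noteq> \<zero>} \<subseteq> {p}" for p
    by (auto simp: clique_basis_def)
  show "compose n m i (clique_basis K p) (clique_basis K q) r = clique_basis K (clique_comp M n m i p q) r"
    unfolding compose_eq_finsum[OF clique_basis_closed[OF assms(1)] clique_basis_closed[OF assms(2)]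
        fin supp[of p] supp[of q]]
    by (auto simp: clique_basis_def)
qed

lemma compose_linear_left:
  assumes "1 \<le> m" "1 \<le> i" "i \<le> n" "g \<in> carrier (CM m)"
  shows "(\<lambda>f. compose n m i f g) \<in> linear_maps K (CM n) (CM (n + m - 1))"
proof -
  interpret V: module K "CM n" by (rule clique_space_module)
  note D = clique_spaceD
  have "compose n m i (f \<oplus>\<^bsub>CM n\<^esub> f') g r = compose n m i f g r \<oplus> compose n m i f' g r"
    if "f \<in> carrier (CM n)" "f' \<in> carrier (CM n)" for f f' r
  proof -
    let ?A = "{p. f p \<noteq> \<zero>} \<union> {p. f' p \<noteq> \<zero>}" and ?B = "{q. g q \<noteq> \<zero>}"
    have fin: "finite ?A" "finite ?B" using that assms D(2) by auto
    have supp: "{p. (f \<oplus>\<^bsub>CM n\<^esub> f') p \<noteq> \<zero>} \<subseteq> ?A" using that by (auto simp: clique_space_simps)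
    show ?thesis
      using that assms D(1)[OF that(1)] D(1)[OF that(2)] D(1)[OF assms(4)]
      unfolding compose_eq_finsum[OF V.M.a_closed[OF that] assms(4) fin supp order_refl]
        compose_eq_finsum[OF that(1) assms(4) fin Un_upper1 order_refl]
        compose_eq_finsum[OF that(2) assms(4) fin Un_upper2 order_refl]
      by (intro trans[OF _ K.finsum_addf] K.finsum_cong')
        (auto simp: clique_space_simps K.l_distr)
  qed
  moreover have "compose n m i (a \<odot>\<^bsub>CM n\<^esub> f) g r = a \<otimes> compose n m i f g r"
    if "a \<in> carrier K" "f \<in> carrier (CM n)" for a f r
  proof -
    let ?A = "{p. f p \<noteq> \<zero>}" and ?B = "{q. g q \<noteq> \<zero>}"
    have fin: "finite ?A" "finite ?B" using that assms D(2) by auto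
    have supp: "{p. (a \<odot>\<^bsub>CM n\<^esub> f) p \<noteq> \<zero>} \<subseteq> ?A" using that by (auto simp: clique_space_simps)
    show ?thesis
      using that assms D(1)[OF that(2)] D(1)[OF assms(4)] fin
      unfolding compose_eq_finsum[OF V.smult_closed[OF that] assms(4) fin supp order_refl]
        compose_eq_finsum[OF that(2) assms(4) fin order_refl order_refl]
      by (intro trans[OF _ K.finsum_rdistr[symmetric]] K.finsum_cong')
        (auto simp: clique_space_simps K.m_assoc)
  qed
  ultimately show ?thesis
    using compose_closed[OF assms(1-3) _ assms(4)]
    by (auto simp: linear_maps_def clique_space_simps(2,3)[where n = "n + m - 1"] fun_eq_iff simp del: One_nat_def)
qed

lemma compose_linear_right:
  assumes "1 \<le> m" "1 \<le> i" "i \<le> n" "f \<in> carrier (CM n)"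
  shows "(\<lambda>g. compose n m i f g) \<in> linear_maps K (CM m) (CM (n + m - 1))"
proof -
  interpret V: module K "CM m" by (rule clique_space_module)
  note D = clique_spaceD
  have "compose n m i f (g \<oplus>\<^bsub>CM m\<^esub> g') r = compose n m i f g r \<oplus> compose n m i f g' r"
    if "g \<in> carrier (CM m)" "g' \<in> carrier (CM m)" for g g' r
  proof -
    let ?A = "{p. f p \<noteq> \<zero>}" and ?B = "{p. g p \<noteq> \<zero>} \<union> {p. g' p \<noteq> \<zero>}"
    have fin: "finite ?A" "finite ?B" using that assms D(2) by auto
    have supp: "{p. (g \<oplus>\<^bsub>CM m\<^esub> g') p \<noteq> \<zero>} \<subseteq> ?B" using that by (auto simp: clique_space_simps)
    show ?thesis
      using that assms D(1)[OF that(1)] D(1)[OF that(2)] D(1)[OF assms(4)]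
      unfolding compose_eq_finsum[OF assms(4) V.M.a_closed[OF that] fin order_refl supp]
        compose_eq_finsum[OF assms(4) that(1) fin order_refl Un_upper1]
        compose_eq_finsum[OF assms(4) that(2) fin order_refl Un_upper2]
      by (intro trans[OF _ K.finsum_addf] K.finsum_cong')
        (auto simp: clique_space_simps K.r_distr)
  qed
  moreover have "compose n m i f (a \<odot>\<^bsub>CM m\<^esub> g) r = a \<otimes> compose n m i f g r"
    if "a \<in> carrier K" "g \<in> carrier (CM m)" for a g r
  proof -
    let ?A = "{p. f p \<noteq> \<zero>}" and ?B = "{q. g q \<noteq> \<zero>}"
    have fin: "finite ?A" "finite ?B" using that assms D(2) by auto
    have supp: "{p. (a \<odot>\<^bsub>CM m\<^esub> g) p \<noteq> \<zero>} \<subseteq> ?B" using that by (auto simp: clique_space_simps)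
    show ?thesis
      using that assms D(1)[OF that(2)] D(1)[OF assms(4)] fin
      unfolding compose_eq_finsum[OF assms(4) V.smult_closed[OF that] fin order_refl supp]
        compose_eq_finsum[OF assms(4) that(2) fin order_refl order_refl]
      by (intro trans[OF _ K.finsum_rdistr[symmetric]] K.finsum_cong')
        (auto simp: clique_space_simps K.m_lcomm)
  qed
  ultimately show ?thesis
    using compose_closed[OF assms(1-4)]
    by (auto simp: linear_maps_def clique_space_simps(2,3)[where n = "n + m - 1"] fun_eq_iff simp del: One_nat_def)
qed

lemma linear_map_eq_on_basis:
  assumes "F \<in> linear_maps K (CM n) (CM m)" "G \<in> linear_maps K (CM n) (CM m)"
    and "\<And>p. p \<in> cliques M n \<Longrightarrow> F (clique_basis K p) = G (clique_basis K p)" and "f \<in> carrier (CM n)"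
  shows "F f = G f"
proof (rule linear_map_eq_on_span[OF clique_space_module clique_space_module assms(1,2) _ _
      clique_space_span[OF assms(4)]])
  show "clique_basis K ` cliques M n \<subseteq> carrier (CM n)" using clique_basis_closed by auto
  show "F s = G s" if "s \<in> clique_basis K ` cliques M n" for s using that assms(3) by auto
qed

lemma trilinear_eq_on_basis:
  fixes F G :: "((nat \<times> nat \<Rightarrow> 'a) \<Rightarrow> 'k) \<Rightarrow> ((nat \<times> nat \<Rightarrow> 'a) \<Rightarrow> 'k) \<Rightarrow> ((nat \<times> nat \<Rightarrow> 'a) \<Rightarrow> 'k)
    \<Rightarrow> (nat \<times> nat \<Rightarrow> 'a) \<Rightarrow> 'k"
  assumes 1: "\<And>H g h. \<lbrakk>H \<in> {F, G}; g \<in> carrier (CM m); h \<in> carrier (CM l)\<rbrakk>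
      \<Longrightarrow> (\<lambda>f. H f g h) \<in> linear_maps K (CM n) (CM k)"
    and 2: "\<And>H f h. \<lbrakk>H \<in> {F, G}; f \<in> carrier (CM n); h \<in> carrier (CM l)\<rbrakk>
      \<Longrightarrow> (\<lambda>g. H f g h) \<in> linear_maps K (CM m) (CM k)"
    and 3: "\<And>H f g. \<lbrakk>H \<in> {F, G}; f \<in> carrier (CM n); g \<in> carrier (CM m)\<rbrakk>
      \<Longrightarrow> (\<lambda>h. H f g h) \<in> linear_maps K (CM l) (CM k)"
    and eq: "\<And>p q r. \<lbrakk>p \<in> cliques M n; q \<in> cliques M m; r \<in> cliques M l\<rbrakk>
      \<Longrightarrow> F (clique_basis K p) (clique_basis K q) (clique_basis K r)
        = G (clique_basis K p) (clique_basis K q) (clique_basis K r)"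
    and fgh: "f \<in> carrier (CM n)" "g \<in> carrier (CM m)" "h \<in> carrier (CM l)"
  shows "F f g h = G f g h"
proof -
  have eq1: "F f (clique_basis K q) (clique_basis K r) = G f (clique_basis K q) (clique_basis K r)"
    if q: "q \<in> cliques M m" and r: "r \<in> cliques M l" for q r
  proof (rule linear_map_eq_on_basis[OF _ _ _ fgh(1)])
    show "(\<lambda>f. F f (clique_basis K q) (clique_basis K r)) \<in> linear_maps K (CM n) (CM k)"
      "(\<lambda>f. G f (clique_basis K q) (clique_basis K r)) \<in> linear_maps K (CM n) (CM k)"
      by (intro 1 clique_basis_closed q r insertI1 insertI2)+
  qed (rule eq[OF _ q r])
  have eq2: "F f g (clique_basis K r) = G f g (clique_basis K r)" if r: "r \<in> cliques M l" for r
  proof (rule linear_map_eq_on_basis[OF _ _ _ fgh(2)])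
    show "(\<lambda>g. F f g (clique_basis K r)) \<in> linear_maps K (CM m) (CM k)"
      "(\<lambda>g. G f g (clique_basis K r)) \<in> linear_maps K (CM m) (CM k)"
      by (intro 2 clique_basis_closed fgh(1) r insertI1 insertI2)+
  qed (rule eq1[OF _ r])
  show ?thesis
  proof (rule linear_map_eq_on_basis[OF _ _ _ fgh(3)])
    show "F f g \<in> linear_maps K (CM l) (CM k)" "G f g \<in> linear_maps K (CM l) (CM k)"
      by (intro 3 fgh(1,2) insertI1 insertI2)+
  qed (rule eq2)
qed

lemma compose_series:
  assumes nm: "1 \<le> l" "1 \<le> i" "i \<le> n" "1 \<le> j" "j \<le> m"
    and fgh: "f \<in> carrier (CM n)" "g \<in> carrier (CM m)" "h \<in> carrier (CM l)"
  shows "compose (n + m - 1) l (i + j - 1) (compose n m i f g) h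
    = compose n (m + l - 1) i f (compose m l j g h)"
proof -
  have ar: "1 \<le> m" "1 \<le> m + l - 1" "1 \<le> i + j - 1" "i + j - 1 \<le> n + m - 1"
    and k: "n + (m + l - 1) - 1 = n + m - 1 + l - 1" using nm by auto
  note c = compose_closed[OF ar(1) nm(2,3)] compose_closed[OF nm(1,4,5)]
  note outer = compose_linear_left[OF nm(1) ar(3,4)] compose_linear_right[OF nm(1) ar(3,4)]
    compose_linear_left[OF ar(2) nm(2,3), unfolded k] compose_linear_right[OF ar(2) nm(2,3), unfolded k]
  note inner = compose_linear_left[OF ar(1) nm(2,3)] compose_linear_right[OF ar(1) nm(2,3)]
    compose_linear_left[OF nm(1,4,5)] compose_linear_right[OF nm(1,4,5)]
  show ?thesis
    using fgh
  proof (rule trilinear_eq_on_basis[where k = "n + m - 1 + l - 1" and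
        F = "\<lambda>f g h. compose (n + m - 1) l (i + j - 1) (compose n m i f g) h" and
        G = "\<lambda>f g h. compose n (m + l - 1) i f (compose m l j g h)", rotated -3])
    fix p q r assume "p \<in> cliques M n" "q \<in> cliques M m" "r \<in> cliques M l"
    then show "compose (n + m - 1) l (i + j - 1) (compose n m i (clique_basis K p) (clique_basis K q)) (clique_basis K r)
      = compose n (m + l - 1) i (clique_basis K p) (compose m l j (clique_basis K q) (clique_basis K r))"
      using nm ar by (simp add: compose_basis clique_comp_closed clique_comp_series del: One_nat_def)
  qed (auto intro: c linear_maps_comp[OF inner(1) outer(1)] linear_maps_comp[OF inner(2) outer(1)] 
      linear_maps_comp[OF inner(3) outer(4)] linear_maps_comp[OF inner(4) outer(4)] outer simp del: One_nat_def)
qed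

lemma compose_parallel:
  assumes nm: "1 \<le> m" "1 \<le> l" "1 \<le> i" "i < j" "j \<le> n"
    and fgh: "f \<in> carrier (CM n)" "g \<in> carrier (CM m)" "h \<in> carrier (CM l)"
  shows "compose (n + m - 1) l (j + m - 1) (compose n m i f g) h
    = compose (n + l - 1) m i (compose n l j f h) g"
proof -
  have ar: "i \<le> n" "1 \<le> j" "i \<le> n + l - 1" "1 \<le> j + m - 1" "j + m - 1 \<le> n + m - 1"
    and k: "n + l - 1 + m - 1 = n + m - 1 + l - 1" using nm by auto
  note c = compose_closed[OF nm(1,3) ar(1)] compose_closed[OF nm(2) ar(2) nm(5)]
  note outer = compose_linear_left[OF nm(2) ar(4,5)] compose_linear_right[OF nm(2) ar(4,5)]
    compose_linear_left[OF nm(1,3) ar(3), unfolded k] compose_linear_right[OF nm(1,3) ar(3), unfolded k]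
  note inner = compose_linear_left[OF nm(1,3) ar(1)] compose_linear_right[OF nm(1,3) ar(1)]
    compose_linear_left[OF nm(2) ar(2) nm(5)] compose_linear_right[OF nm(2) ar(2) nm(5)]
  show ?thesis
    using fgh
  proof (rule trilinear_eq_on_basis[where k = "n + m - 1 + l - 1" and
        F = "\<lambda>f g h. compose (n + m - 1) l (j + m - 1) (compose n m i f g) h" and
        G = "\<lambda>f g h. compose (n + l - 1) m i (compose n l j f h) g", rotated -3])
    fix p q r assume "p \<in> cliques M n" "q \<in> cliques M m" "r \<in> cliques M l"
    then show "compose (n + m - 1) l (j + m - 1) (compose n m i (clique_basis K p) (clique_basis K q)) (clique_basis K r)
      = compose (n + l - 1) m i (compose n l j (clique_basis K p) (clique_basis K r)) (clique_basis K q)"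
      using nm ar by (simp add: compose_basis clique_comp_closed clique_comp_parallel del: One_nat_def)
  qed (auto intro: c linear_maps_comp[OF inner(1) outer(1)] linear_maps_comp[OF inner(2) outer(1)] 
      linear_maps_comp[OF inner(3) outer(3)] linear_maps_comp[OF inner(4) outer(3)] outer simp del: One_nat_def)
qed

theorem clique_operad: "ns_operad K (clique_operad K M)"
proof -
  have comp: "component (clique_operad K M) = clique_space K M" and
    unit: "operad_unit (clique_operad K M) = clique_basis K (unit_clique M)"
    by (simp_all add: clique_operad_def)
  note L = compose_linear_left[unfolded linear_maps_def] compose_linear_right[unfolded linear_maps_def]
  have id: "(\<lambda>f. f) \<in> linear_maps K (CM n) (CM n)" for n by (simp add: linear_maps_def)
  have U: "clique_basis K (unit_clique M) \<in> carrier (CM 1)"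
    by (rule clique_basis_closed[OF unit_clique_closed])
  have unit_left: "compose 1 n 1 (clique_basis K (unit_clique M)) f = f" if "1 \<le> n" "f \<in> carrier (CM n)" for n f
  proof (rule linear_map_eq_on_basis[OF _ id _ that(2)])
    show "compose 1 n 1 (clique_basis K (unit_clique M)) \<in> linear_maps K (CM n) (CM n)"
      using compose_linear_right[OF that(1) order_refl order_refl U] by simp
  qed (simp add: that compose_basis[OF unit_clique_closed] clique_comp_unit_left del: One_nat_def)
  have unit_right: "compose n 1 i f (clique_basis K (unit_clique M)) = f"
    if "1 \<le> i" "i \<le> n" "f \<in> carrier (CM n)" for n i f
  proof (rule linear_map_eq_on_basis[OF _ id _ that(3), where F = "\<lambda>f. compose n 1 i f (clique_basis K (unit_clique M))"])
    show "(\<lambda>f. compose n 1 i f (clique_basis K (unit_clique M))) \<in> linear_maps K (CM n) (CM n)"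
      using compose_linear_left[OF order_refl that(1,2) U] by simp
  qed (simp add: that compose_basis[OF _ unit_clique_closed] clique_comp_unit_right del: One_nat_def)
  show ?thesis
  proof (intro ns_operad.intro ns_operad_axioms.intro, unfold comp unit)
    show "field K" by (rule K.field_axioms)
  qed (use L in \<open>auto intro: compose_closed compose_series compose_parallel unit_left unit_right U clique_space_module
        simp del: One_nat_def\<close>)
qed


section \<open>The ideal of bubble relations\<close>

text \<open>
  For a composition with one factor in the span of the non-bubbles, linearity in both arguments reduces
  membership to the composition of two cliques one of which is not a bubble.
\<close>

lemma bubble_relations_ideal: "operad_ideal K (clique_operad K M) (bubble_relations K M)"
proof -
  have comp: "component (clique_operad K M) = clique_space K M" by (simp add: clique_operad_def)
  define S where "S n = clique_basis K ` (cliques M n - bubbles M n)" for n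
  have I: "bubble_relations K M n = module_span K (CM n) (S n)" for n
    by (simp add: bubble_relations_def S_def)
  have S: "S n \<subseteq> carrier (CM n)" for n by (auto simp: S_def clique_basis_closed)
  have sub: "submodule (bubble_relations K M n) K (CM n)" for n
    unfolding I using clique_space_module S by (rule module_span_submodule)
  have sup: "S n \<subseteq> bubble_relations K M n" for n unfolding I by (rule module_span_superset)
  have B: "clique_basis K ` cliques M n \<subseteq> carrier (CM n)" for n using clique_basis_closed by auto
  note span = linear_map_span[OF clique_space_module clique_space_module]
  have right: "compose n m i f g \<in> bubble_relations K M (n + m - 1)"
    if nm: "1 \<le> m" "1 \<le> i" "i \<le> n" and f: "f \<in> carrier (CM n)" and g: "g \<in> bubble_relations K M m" for n m i f g
  proof (rule span[OF compose_linear_right[OF nm f] sub S _ g[unfolded I]])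
    fix s assume "s \<in> S m"
    then obtain q where q: "q \<in> cliques M m - bubbles M m" "s = clique_basis K q" by (auto simp: S_def)
    show "compose n m i f s \<in> bubble_relations K M (n + m - 1)"
    proof (rule span[OF compose_linear_left[OF nm] sub B _ clique_space_span[OF f]])
      show "s \<in> carrier (CM m)" using S \<open>s \<in> S m\<close> by auto
      fix t assume "t \<in> clique_basis K ` cliques M n"
      then obtain p where p: "p \<in> cliques M n" "t = clique_basis K p" by auto
      have "compose n m i t s \<in> S (n + m - 1)"
        using p q clique_comp_not_bubble_right[OF nm p(1) q(1)] by (simp add: compose_basis S_def)
      then show "compose n m i t s \<in> bubble_relations K M (n + m - 1)" using sup by auto
    qed
  qed
  have left: "compose n m i f g \<in> bubble_relations K M (n + m - 1)"
    if nm: "1 \<le> m" "1 \<le> i" "i \<le> n" and f: "f \<in> bubble_relations K M n" and g: "g \<in> carrier (CM m)" for n m i f g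
  proof (rule span[OF compose_linear_left[OF nm g] sub S _ f[unfolded I]])
    fix s assume "s \<in> S n"
    then obtain p where p: "p \<in> cliques M n - bubbles M n" "s = clique_basis K p" by (auto simp: S_def)
    show "compose n m i s g \<in> bubble_relations K M (n + m - 1)"
    proof (rule span[OF compose_linear_right[OF nm] sub B _ clique_space_span[OF g]])
      show "s \<in> carrier (CM n)" using S \<open>s \<in> S n\<close> by auto
      fix t assume "t \<in> clique_basis K ` cliques M m"
      then obtain q where q: "q \<in> cliques M m" "t = clique_basis K q" by auto
      have "compose n m i s t \<in> S (n + m - 1)"
        using p q clique_comp_not_bubble_left[OF nm p(1) q(1)] by (simp add: compose_basis S_def)
      then show "compose n m i s t \<in> bubble_relations K M (n + m - 1)" using sup by auto
    qed
  qed
  show ?thesis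
    by (intro operad_ideal.intro operad_ideal_axioms.intro clique_operad) (simp_all only: comp sub left right)
qed

end

theorem proposition3p1p4:
  fixes K :: "('k, 'l) ring_scheme" and M :: "('a, 'm) monoid_scheme"
  assumes "field K"
    and "\<forall>n::nat. n > 0 \<longrightarrow> [n] \<cdot>\<^bsub>K\<^esub> \<one>\<^bsub>K\<^esub> \<noteq> \<zero>\<^bsub>K\<^esub>"
    and "unitary_magma M"
  shows "operad_ideal K (clique_operad K M) (bubble_relations K M)
    \<and> ns_operad K (bubble_operad K M)"
proof -
  interpret linear_cliques K M
    using assms(1,3) by (rule linear_cliques.intro)
  show ?thesis
    using bubble_relations_ideal operad_ideal.quotient_operad[OF bubble_relations_ideal]
    by (simp add: bubble_operad_def)
qed

end
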